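(* Let $k\ge 1$, let $\Lambda$ be a connected $k$-graph, and let $v\in\Lambda^0$. Then the map $t$, which sends an undirected path $h=h_1^{m_1}\cdots h_n^{m_n}$ in $\mathrm{Sk}_\Lambda$ (with $h_i\in\mathrm{Sk}_\Lambda^1$, $m_i=\pm1$) to $t(h)=\sum_{i=1}^n m_i h_i\in C_1(\Lambda)$, induces (via $[h]\mapsto [t(h)]$ for undirected paths $h$ with $r(h)=s(h)=v$) an isomorphism $$\operatorname{Ab}\pi_1(\Lambda,v)\;\cong\; H_1(\Lambda)$$ from the abelianisation of the fundamental group of $\Lambda$ onto its first homology group.
   Context: **$k$-graphs.** $\mathbb{N}^k$ is the additive monoid of $k$-tuples of natural numbers (including $0$) with canonical generators $e_1,\dots,e_k$. A $k$-graph is a countable category $\Lambda$ with a functor $d:\Lambda\to\mathbb{N}^k$ satisfying the factorisation property: if $\lambda\in\Lambda$ and $d(\lambda)=m+n$ with $m,n\in\mathbb{N}^k$, then there are unique $\mu,\nu\in\Lambda$ with $d(\mu)=m$, $d(\nu)=n$ and $\lambda=\mu\nu$. Write $r$ and $s$ for codomain and domain; $\mu\nu$ is defined when $s(\mu)=r(\nu)$. Put $\Lambda^m=d^{-1}(m)$; $\Lambda^0$ is identified with the set of objects (vertices). $\Lambda$ is connected if the equivalence relation on $\Lambda^0$ generated by "$u\sim w$ iff there is $\lambda\in\Lambda$ with $r(\lambda)=u$, $s(\lambda)=w$" is all of $\Lambda^0\times\Lambda^0$. **$1$-skeleton and undirected paths.** $E=\mathrm{Sk}_\Lambda$ is the directed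 graph with $E^0=\Lambda^0$, $E^1=\bigcup_{i\le k}\Lambda^{e_i}$, and $r,s$ inherited from $\Lambda$. In a directed graph a path of length $n$ is a sequence $\mu_1\cdots\mu_n$ of edges with $s(\mu_i)=r(\mu_{i+1})$; its range is $r(\mu_1)$ and its source is $s(\mu_n)$; vertices are paths of length $0$. $\mathcal{P}(E)$ denotes the category of finite paths. For each $e\in E^1$ introduce a formal inverse edge $e^{-1}$ with $s(e^{-1})=r(e)$, $r(e^{-1})=s(e)$; set $E^u=E^1\cup\{e^{-1}:e\in E^1\}$, $(e^{-1})^{-1}=e$, and let $E^+$ be the directed graph $(E^0,E^u,r,s)$. Elements of $\mathcal{P}(E^+)$ are called undirected paths in $E$. **Relations.** $C=\{(e^{-1}e,s(e)):e\in E^u\}$. The commuting squares of $\Lambda$ are the pairs $(fg,g'f')$ of length-two paths in $E$ where, for some $i\neq j$, $f,f'\in\Lambda^{e_i}$, $g,g'\in\Lambda^{e_j}$, and $fg=g'f'$ in $\Lambda$. $S$ is the equivalence relation on $\mathcal{P}(E)$ generated by replacing, in a path, two consecutive edges forming one side of a commuting square by the other side. $S^+$ is the relation on $\mathcal{P}(E^+)$ obtained from $S$ by adding $(f^{-1}e^{-1},h^{-1}g^{-1})$ whenever $(ef,gh)\in S$ (with $e,f,g,h\in E^1$). **Fundamental group.** $\mathcal{G}(\Lambda)=\mathcal{P}(\mathrm{Sk}_\Lambda^+)/(C\cup S^+)$ is the quotient category by the smallest congruence (equivalence relation on morphisms, preserving range and source, compatible with composition) containing $C\cup S^+$; it is a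 groupoid with object set $\Lambda^0$. $\pi_1(\Lambda,v)=v\,\mathcal{G}(\Lambda)\,v$ is the group of its elements with range and source $v$; $[h]$ denotes the class of an undirected path $h$. Up to isomorphism this group does not depend on $v$. **Homology.** $\mathbb{Z}X$ is the free abelian group on a set $X$. Put $C_0(\Lambda)=\mathbb{Z}\Lambda^0$, $C_1(\Lambda)=\mathbb{Z}\Lambda^{e_1}\oplus\cdots\oplus\mathbb{Z}\Lambda^{e_k}$, $C_2(\Lambda)=\bigoplus_{1\le i<j\le k}\mathbb{Z}\Lambda^{e_i+e_j}$. The homomorphism $\partial_1^\Lambda:C_1(\Lambda)\to C_0(\Lambda)$ is determined by $\partial_1^\Lambda(\lambda)=s(\lambda)-r(\lambda)$. The homomorphism $\partial_2^\Lambda:C_2(\Lambda)\to C_1(\Lambda)$ is determined as follows: for $\lambda\in\Lambda^{e_i+e_j}$ with $i<j$, factorise $\lambda=f_1g_1=g_2f_2$ with $f_1,f_2\in\Lambda^{e_i}$ and $g_1,g_2\in\Lambda^{e_j}$, and set $\partial_2^\Lambda(\lambda)=f_1+g_1-f_2-g_2$. Then $\partial_1^\Lambda\circ\partial_2^\Lambda=0$ and $H_1(\Lambda)=\ker\partial_1^\Lambda/\operatorname{Im}\partial_2^\Lambda$. *)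

theory Defs
  imports
    "HOL-Library.Countable_Set"
    "HOL-Algebra.Generated_Groups"
    "HOL-Algebra.Free_Abelian_Groups"
begin

section \<open>Categories, congruences and quotients\<close>

text \<open>
  Categories are presented by their morphisms alone: an object is identified with its identity
  morphism, so \<open>rng f\<close> (codomain) and \<open>src f\<close> (domain) are themselves morphisms.
  \<open>cmp f g\<close> is the composite \<open>fg\<close>, meaningful when \<open>src f = rng g\<close>.
\<close>

record 'a cat =
  Mor :: "'a set"
  rng :: "'a \<Rightarrow> 'a"
  src :: "'a \<Rightarrow> 'a"
  cmp :: "'a \<Rightarrow> 'a \<Rightarrow> 'a"

locale category =
  fixes C :: "('a, 'b) cat_scheme"
  assumes rng_closed: "f \<in> Mor C \<Longrightarrow> rng C f \<in> Mor C"
    and src_closed: "f \<in> Mor C \<Longrightarrow> src C f \<in> Mor C"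
    and rng_rng: "f \<in> Mor C \<Longrightarrow> rng C (rng C f) = rng C f"
    and src_rng: "f \<in> Mor C \<Longrightarrow> src C (rng C f) = rng C f"
    and rng_src: "f \<in> Mor C \<Longrightarrow> rng C (src C f) = src C f"
    and src_src: "f \<in> Mor C \<Longrightarrow> src C (src C f) = src C f"
    and cmp_closed: "\<lbrakk>f \<in> Mor C; g \<in> Mor C; src C f = rng C g\<rbrakk> \<Longrightarrow> cmp C f g \<in> Mor C"
    and rng_cmp: "\<lbrakk>f \<in> Mor C; g \<in> Mor C; src C f = rng C g\<rbrakk> \<Longrightarrow> rng C (cmp C f g) = rng C f"
    and src_cmp: "\<lbrakk>f \<in> Mor C; g \<in> Mor C; src C f = rng C g\<rbrakk> \<Longrightarrow> src C (cmp C f g) = src C g"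
    and cmp_rng: "f \<in> Mor C \<Longrightarrow> cmp C (rng C f) f = f"
    and cmp_src: "f \<in> Mor C \<Longrightarrow> cmp C f (src C f) = f"
    and cmp_assoc: "\<lbrakk>f \<in> Mor C; g \<in> Mor C; h \<in> Mor C; src C f = rng C g; src C g = rng C h\<rbrakk>
      \<Longrightarrow> cmp C (cmp C f g) h = cmp C f (cmp C g h)"

definition congruence :: "('a, 'b) cat_scheme \<Rightarrow> ('a \<times> 'a) set \<Rightarrow> bool" where
  "congruence C T \<longleftrightarrow>
     equiv (Mor C) T \<and>
     (\<forall>(f, f') \<in> T. rng C f = rng C f' \<and> src C f = src C f') \<and>
     (\<forall>(f, f') \<in> T. \<forall>(g, g') \<in> T. src C f = rng C g \<longrightarrow> (cmp C f g, cmp C f' g') \<in> T)"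

definition generated_congruence :: "('a, 'b) cat_scheme \<Rightarrow> ('a \<times> 'a) set \<Rightarrow> ('a \<times> 'a) set" where
  "generated_congruence C R = \<Inter> {T. congruence C T \<and> R \<subseteq> T}"

text \<open>The unions below are the single class determined by any choice of representatives.\<close>

definition quotient_category :: "('a, 'b) cat_scheme \<Rightarrow> ('a \<times> 'a) set \<Rightarrow> 'a set cat" where
  "quotient_category C T =
     \<lparr>Mor = Mor C // T,
      rng = (\<lambda>X. \<Union>f\<in>X. T `` {rng C f}),
      src = (\<lambda>X. \<Union>f\<in>X. T `` {src C f}),
      cmp = (\<lambda>X Y. \<Union>f\<in>X. \<Union>g\<in>Y. T `` {cmp C f g})\<rparr>"

definition vertex_group :: "('a, 'b) cat_scheme \<Rightarrow> 'a \<Rightarrow> 'a monoid" where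
  "vertex_group C u =
     \<lparr>carrier = {f \<in> Mor C. rng C f = u \<and> src C f = u}, monoid.mult = cmp C, one = u\<rparr>"

section \<open>Directed graphs and their path categories\<close>

record ('v, 'e) digraph =
  verts :: "'v set"
  edges :: "'e set"
  erng :: "'e \<Rightarrow> 'v"
  esrc :: "'e \<Rightarrow> 'v"

text \<open>
  A path is stored as its range together with its list of edges;
  \<open>(u, [])\<close> is the vertex \<open>u\<close> regarded as a path of length \<open>0\<close>.
\<close>

definition paths :: "('v, 'e) digraph \<Rightarrow> ('v \<times> 'e list) set" where
  "paths G = {(u, es). u \<in> verts G \<and> set es \<subseteq> edges G \<and>
     (es \<noteq> [] \<longrightarrow> erng G (hd es) = u) \<and> successively (\<lambda>e f. esrc G e = erng G f) es}"

definition path_source :: "('v, 'e) digraph \<Rightarrow> 'v \<times> 'e list \<Rightarrow> 'v" where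
  "path_source G p = (if snd p = [] then fst p else esrc G (last (snd p)))"

definition path_category :: "('v, 'e) digraph \<Rightarrow> ('v \<times> 'e list) cat" where
  "path_category G =
     \<lparr>Mor = paths G,
      rng = (\<lambda>p. (fst p, [])),
      src = (\<lambda>p. (path_source G p, [])),
      cmp = (\<lambda>p q. (fst p, snd p @ snd q))\<rparr>"

datatype 'e uedge = Fwd 'e | Bwd 'e

primrec einv :: "'e uedge \<Rightarrow> 'e uedge" where
  "einv (Fwd e) = Bwd e"
| "einv (Bwd e) = Fwd e"

definition undirected :: "('v, 'e) digraph \<Rightarrow> ('v, 'e uedge) digraph" where
  "undirected G =
     \<lparr>verts = verts G,
      edges = Fwd ` edges G \<union> Bwd ` edges G,
      erng = case_uedge (erng G) (esrc G),
      esrc = case_uedge (esrc G) (erng G)\<rparr>"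

section \<open>Higher-rank graphs\<close>

text \<open>
  \<open>\<nat>\<^sup>k\<close> is the set of functions \<open>nat \<Rightarrow> nat\<close> vanishing outside \<open>{1..k}\<close>.
\<close>

definition degrees :: "nat \<Rightarrow> (nat \<Rightarrow> nat) set" where
  "degrees k = {m. \<forall>i. i \<notin> {1..k} \<longrightarrow> m i = 0}"

definition unit_deg :: "nat \<Rightarrow> nat \<Rightarrow> nat" where
  "unit_deg i = (\<lambda>j. if j = i then 1 else 0)"

definition add_deg :: "(nat \<Rightarrow> nat) \<Rightarrow> (nat \<Rightarrow> nat) \<Rightarrow> nat \<Rightarrow> nat" where
  "add_deg m n = (\<lambda>i. m i + n i)"

record 'a kgraph = "'a cat" +
  deg :: "'a \<Rightarrow> nat \<Rightarrow> nat"

definition graded :: "('a, 'b) kgraph_scheme \<Rightarrow> (nat \<Rightarrow> nat) \<Rightarrow> 'a set" where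
  "graded \<Lambda> m = {x \<in> Mor \<Lambda>. deg \<Lambda> x = m}"

locale kgraph = category \<Lambda> for k :: nat and \<Lambda> :: "('a, 'b) kgraph_scheme" +
  assumes countable_Mor: "countable (Mor \<Lambda>)"
    and deg_degrees: "x \<in> Mor \<Lambda> \<Longrightarrow> deg \<Lambda> x \<in> degrees k"
    and deg_identity: "x \<in> Mor \<Lambda> \<Longrightarrow> rng \<Lambda> x = x \<Longrightarrow> deg \<Lambda> x = (\<lambda>_. 0)"
    and deg_cmp: "\<lbrakk>x \<in> Mor \<Lambda>; y \<in> Mor \<Lambda>; src \<Lambda> x = rng \<Lambda> y\<rbrakk>
      \<Longrightarrow> deg \<Lambda> (cmp \<Lambda> x y) = add_deg (deg \<Lambda> x) (deg \<Lambda> y)"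
    and factorisation: "\<lbrakk>x \<in> Mor \<Lambda>; m \<in> degrees k; n \<in> degrees k; deg \<Lambda> x = add_deg m n\<rbrakk>
      \<Longrightarrow> \<exists>!(y, z). y \<in> graded \<Lambda> m \<and> z \<in> graded \<Lambda> n \<and> src \<Lambda> y = rng \<Lambda> z \<and> x = cmp \<Lambda> y z"

definition vertices :: "('a, 'b) kgraph_scheme \<Rightarrow> 'a set" where
  "vertices \<Lambda> = graded \<Lambda> (\<lambda>_. 0)"

definition kgraph_connected :: "('a, 'b) kgraph_scheme \<Rightarrow> bool" where
  "kgraph_connected \<Lambda> \<longleftrightarrow>
     (\<forall>u \<in> vertices \<Lambda>. \<forall>w \<in> vertices \<Lambda>.
        equivclp (\<lambda>u w. \<exists>x \<in> Mor \<Lambda>. rng \<Lambda> x = u \<and> src \<Lambda> x = w) u w)"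

definition skeleton :: "nat \<Rightarrow> ('a, 'b) kgraph_scheme \<Rightarrow> ('a, 'a) digraph" where
  "skeleton k \<Lambda> =
     \<lparr>verts = vertices \<Lambda>,
      edges = (\<Union>i\<in>{1..k}. graded \<Lambda> (unit_deg i)),
      erng = rng \<Lambda>,
      esrc = src \<Lambda>\<rparr>"

section \<open>The fundamental group\<close>

definition undirected_paths :: "nat \<Rightarrow> ('a, 'b) kgraph_scheme \<Rightarrow> ('a \<times> 'a uedge list) cat" where
  "undirected_paths k \<Lambda> = path_category (undirected (skeleton k \<Lambda>))"

definition cancel_rel :: "('v, 'e) digraph \<Rightarrow> (('v \<times> 'e uedge list) \<times> ('v \<times> 'e uedge list)) set" where
  "cancel_rel G =
     {((esrc (undirected G) e, [einv e, e]), (esrc (undirected G) e, [])) | e.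
        e \<in> edges (undirected G)}"

definition commuting_squares ::
    "nat \<Rightarrow> ('a, 'b) kgraph_scheme \<Rightarrow> (('a \<times> 'a list) \<times> ('a \<times> 'a list)) set" where
  "commuting_squares k \<Lambda> =
     {((rng \<Lambda> f, [f, g]), (rng \<Lambda> g', [g', f'])) | f g f' g'.
        \<exists>i\<in>{1..k}. \<exists>j\<in>{1..k}. i \<noteq> j \<and>
          f \<in> graded \<Lambda> (unit_deg i) \<and> f' \<in> graded \<Lambda> (unit_deg i) \<and>
          g \<in> graded \<Lambda> (unit_deg j) \<and> g' \<in> graded \<Lambda> (unit_deg j) \<and>
          src \<Lambda> f = rng \<Lambda> g \<and> src \<Lambda> g' = rng \<Lambda> f' \<and>
          cmp \<Lambda> f g = cmp \<Lambda> g' f'}"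

definition square_step ::
    "nat \<Rightarrow> ('a, 'b) kgraph_scheme \<Rightarrow> 'a \<times> 'a list \<Rightarrow> 'a \<times> 'a list \<Rightarrow> bool" where
  "square_step k \<Lambda> p q \<longleftrightarrow>
     (let P = path_category (skeleton k \<Lambda>) in
        \<exists>a \<in> Mor P. \<exists>b \<in> Mor P. \<exists>(s, s') \<in> commuting_squares k \<Lambda>.
          src P a = rng P s \<and> src P s = rng P b \<and>
          p = cmp P a (cmp P s b) \<and> q = cmp P a (cmp P s' b))"

definition square_rel ::
    "nat \<Rightarrow> ('a, 'b) kgraph_scheme \<Rightarrow> (('a \<times> 'a list) \<times> ('a \<times> 'a list)) set" where
  "square_rel k \<Lambda> =
     {(p, q). p \<in> paths (skeleton k \<Lambda>) \<and> q \<in> paths (skeleton k \<Lambda>) \<and> equivclp (square_step k \<Lambda>) p q}"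

text \<open>The first part is \<open>square_rel\<close> transported along the inclusion of directed into undirected paths.\<close>

definition square_rel_plus ::
    "nat \<Rightarrow> ('a, 'b) kgraph_scheme \<Rightarrow> (('a \<times> 'a uedge list) \<times> ('a \<times> 'a uedge list)) set" where
  "square_rel_plus k \<Lambda> =
     {((u, map Fwd es), (w, map Fwd fs)) | u es w fs. ((u, es), (w, fs)) \<in> square_rel k \<Lambda>} \<union>
     {((src \<Lambda> f, [Bwd f, Bwd e]), (src \<Lambda> h, [Bwd h, Bwd g])) | e f g h.
        {e, f, g, h} \<subseteq> edges (skeleton k \<Lambda>) \<and>
        ((rng \<Lambda> e, [e, f]), (rng \<Lambda> g, [g, h])) \<in> square_rel k \<Lambda>}"

definition homotopy ::
    "nat \<Rightarrow> ('a, 'b) kgraph_scheme \<Rightarrow> (('a \<times> 'a uedge list) \<times> ('a \<times> 'a uedge list)) set" where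
  "homotopy k \<Lambda> =
     generated_congruence (undirected_paths k \<Lambda>)
       (cancel_rel (skeleton k \<Lambda>) \<union> square_rel_plus k \<Lambda>)"

definition fundamental_groupoid ::
    "nat \<Rightarrow> ('a, 'b) kgraph_scheme \<Rightarrow> ('a \<times> 'a uedge list) set cat" where
  "fundamental_groupoid k \<Lambda> = quotient_category (undirected_paths k \<Lambda>) (homotopy k \<Lambda>)"

definition path_class ::
    "nat \<Rightarrow> ('a, 'b) kgraph_scheme \<Rightarrow> 'a \<times> 'a uedge list \<Rightarrow> ('a \<times> 'a uedge list) set" where
  "path_class k \<Lambda> h = homotopy k \<Lambda> `` {h}"

definition fundamental_group ::
    "nat \<Rightarrow> ('a, 'b) kgraph_scheme \<Rightarrow> 'a \<Rightarrow> ('a \<times> 'a uedge list) set monoid" where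
  "fundamental_group k \<Lambda> v =
     vertex_group (fundamental_groupoid k \<Lambda>) (path_class k \<Lambda> (v, []))"

definition abelianisation :: "('a, 'b) monoid_scheme \<Rightarrow> 'a set monoid" where
  "abelianisation G = G Mod derived G (carrier G)"

definition abelianisation_class :: "('a, 'b) monoid_scheme \<Rightarrow> 'a \<Rightarrow> 'a set" where
  "abelianisation_class G x = derived G (carrier G) #>\<^bsub>G\<^esub> x"

section \<open>The first homology group\<close>

text \<open>
  The sets \<open>\<Lambda>\<^bsup>e\<^sub>i\<^esup>\<close> are pairwise disjoint, as are the sets \<open>\<Lambda>\<^bsup>e\<^sub>i+e\<^sub>j\<^esup>\<close> for \<open>i < j\<close>, so the direct sums of
  free abelian groups in degrees 1 and 2 are taken to be free abelian groups on the unions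
  (see \<open>iso_free_Abelian_group_sum\<close>).
\<close>

definition C0 :: "('a, 'b) kgraph_scheme \<Rightarrow> ('a \<Rightarrow>\<^sub>0 int) monoid" where
  "C0 \<Lambda> = free_Abelian_group (vertices \<Lambda>)"

definition C1 :: "nat \<Rightarrow> ('a, 'b) kgraph_scheme \<Rightarrow> ('a \<Rightarrow>\<^sub>0 int) monoid" where
  "C1 k \<Lambda> = free_Abelian_group (\<Union>i\<in>{1..k}. graded \<Lambda> (unit_deg i))"

definition C2 :: "nat \<Rightarrow> ('a, 'b) kgraph_scheme \<Rightarrow> ('a \<Rightarrow>\<^sub>0 int) monoid" where
  "C2 k \<Lambda> = free_Abelian_group
     (\<Union>(i, j)\<in>{(i, j). 1 \<le> i \<and> i < j \<and> j \<le> k}. graded \<Lambda> (add_deg (unit_deg i) (unit_deg j)))"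

definition boundary1 :: "('a, 'b) kgraph_scheme \<Rightarrow> ('a \<Rightarrow>\<^sub>0 int) \<Rightarrow> ('a \<Rightarrow>\<^sub>0 int)" where
  "boundary1 \<Lambda> = frag_extend (\<lambda>x. frag_of (src \<Lambda> x) - frag_of (rng \<Lambda> x))"

definition square_factors ::
    "('a, 'b) kgraph_scheme \<Rightarrow> nat \<Rightarrow> nat \<Rightarrow> 'a \<Rightarrow> 'a \<Rightarrow> 'a \<Rightarrow> 'a \<Rightarrow> 'a \<Rightarrow> bool" where
  "square_factors \<Lambda> i j x f\<^sub>1 g\<^sub>1 f\<^sub>2 g\<^sub>2 \<longleftrightarrow>
     f\<^sub>1 \<in> graded \<Lambda> (unit_deg i) \<and> f\<^sub>2 \<in> graded \<Lambda> (unit_deg i) \<and>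
     g\<^sub>1 \<in> graded \<Lambda> (unit_deg j) \<and> g\<^sub>2 \<in> graded \<Lambda> (unit_deg j) \<and>
     src \<Lambda> f\<^sub>1 = rng \<Lambda> g\<^sub>1 \<and> x = cmp \<Lambda> f\<^sub>1 g\<^sub>1 \<and>
     src \<Lambda> g\<^sub>2 = rng \<Lambda> f\<^sub>2 \<and> x = cmp \<Lambda> g\<^sub>2 f\<^sub>2"

text \<open>
  The description is definite on the generators of \<open>C2\<close>: the degree of \<open>x\<close> determines \<open>i < j\<close>, and
  the factorisation property determines the four edges; see \<open>square_boundary_eq\<close> below.
\<close>

definition square_boundary :: "nat \<Rightarrow> ('a, 'b) kgraph_scheme \<Rightarrow> 'a \<Rightarrow> ('a \<Rightarrow>\<^sub>0 int)" where
  "square_boundary k \<Lambda> x = (THE c. \<exists>i j f\<^sub>1 g\<^sub>1 f\<^sub>2 g\<^sub>2.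
     1 \<le> i \<and> i < j \<and> j \<le> k \<and> square_factors \<Lambda> i j x f\<^sub>1 g\<^sub>1 f\<^sub>2 g\<^sub>2 \<and>
     c = frag_of f\<^sub>1 + frag_of g\<^sub>1 - frag_of f\<^sub>2 - frag_of g\<^sub>2)"

definition boundary2 :: "nat \<Rightarrow> ('a, 'b) kgraph_scheme \<Rightarrow> ('a \<Rightarrow>\<^sub>0 int) \<Rightarrow> ('a \<Rightarrow>\<^sub>0 int)" where
  "boundary2 k \<Lambda> = frag_extend (square_boundary k \<Lambda>)"

definition Z1 :: "nat \<Rightarrow> ('a, 'b) kgraph_scheme \<Rightarrow> ('a \<Rightarrow>\<^sub>0 int) monoid" where
  "Z1 k \<Lambda> = (C1 k \<Lambda>)\<lparr>carrier := kernel (C1 k \<Lambda>) (C0 \<Lambda>) (boundary1 \<Lambda>)\<rparr>"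

definition B1 :: "nat \<Rightarrow> ('a, 'b) kgraph_scheme \<Rightarrow> ('a \<Rightarrow>\<^sub>0 int) set" where
  "B1 k \<Lambda> = boundary2 k \<Lambda> ` carrier (C2 k \<Lambda>)"

definition H1 :: "nat \<Rightarrow> ('a, 'b) kgraph_scheme \<Rightarrow> ('a \<Rightarrow>\<^sub>0 int) set monoid" where
  "H1 k \<Lambda> = Z1 k \<Lambda> Mod B1 k \<Lambda>"

definition homology_class :: "nat \<Rightarrow> ('a, 'b) kgraph_scheme \<Rightarrow> ('a \<Rightarrow>\<^sub>0 int) \<Rightarrow> ('a \<Rightarrow>\<^sub>0 int) set" where
  "homology_class k \<Lambda> c = B1 k \<Lambda> #>\<^bsub>Z1 k \<Lambda>\<^esub> c"

definition path_chain :: "'v \<times> 'e uedge list \<Rightarrow> ('e \<Rightarrow>\<^sub>0 int)" where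
  "path_chain h = (\<Sum>e\<leftarrow>snd h. case e of Fwd f \<Rightarrow> frag_of f | Bwd f \<Rightarrow> - frag_of f)"

section \<open>Well-definedness\<close>

lemma congruence_generated:
  assumes "category C" and "R \<subseteq> Mor C \<times> Mor C"
    and "\<And>f f'. (f, f') \<in> R \<Longrightarrow> rng C f = rng C f' \<and> src C f = src C f'"
  shows "congruence C (generated_congruence C R)" and "R \<subseteq> generated_congruence C R"
proof -
  interpret category C by fact
  let ?T = "{(f, f'). f \<in> Mor C \<and> f' \<in> Mor C \<and> rng C f = rng C f' \<and> src C f = src C f'}"
  have T: "congruence C ?T" "R \<subseteq> ?T"
    using assms(2,3)
    by (auto simp: congruence_def equiv_def refl_on_def sym_def trans_def
        cmp_closed rng_cmp src_cmp)
  let ?\<F> = "{T. congruence C T \<and> R \<subseteq> T}"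
  have "\<Inter>?\<F> \<subseteq> ?T"
    using T by blast
  moreover have "refl_on (Mor C) (\<Inter>?\<F>)"
    by (simp add: refl_on_def congruence_def equiv_def)
  moreover have "sym (\<Inter>?\<F>)"
    by (rule symI) (auto simp: congruence_def equiv_def dest: symD)
  moreover have "trans (\<Inter>?\<F>)"
    by (rule transI) (auto simp: congruence_def equiv_def dest: transD)
  moreover have "(cmp C f g, cmp C f' g') \<in> \<Inter>?\<F>"
    if "(f, f') \<in> \<Inter>?\<F>" "(g, g') \<in> \<Inter>?\<F>" "src C f = rng C g" for f f' g g'
  proof (rule InterI)
    fix T assume T: "T \<in> ?\<F>"
    then have "(f, f') \<in> T" "(g, g') \<in> T"
      using that(1,2) by auto
    then show "(cmp C f g, cmp C f' g') \<in> T"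
      using T that(3) unfolding congruence_def by blast
  qed
  ultimately have "congruence C (\<Inter>?\<F>)"
    unfolding congruence_def[of C "\<Inter>?\<F>"] equiv_def by auto
  then show "congruence C (generated_congruence C R)"
    by (simp add: generated_congruence_def)
  show "R \<subseteq> generated_congruence C R"
    by (auto simp: generated_congruence_def)
qed

lemma unit_deg_degrees: "i \<in> {1..k} \<Longrightarrow> unit_deg i \<in> degrees k"
  by (auto simp: degrees_def unit_deg_def)

lemma add_deg_commute: "add_deg m n = add_deg n m"
  by (auto simp: add_deg_def)

lemma add_unit_deg_inject:
  assumes "add_deg (unit_deg i) (unit_deg j) = add_deg (unit_deg i') (unit_deg j')"
    and "i < j" "i' < j'"
  shows "i = i' \<and> j = j'"
proof -
  have "{l. add_deg (unit_deg i) (unit_deg j) l \<noteq> 0} = {i, j}" for i j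
    by (auto simp: add_deg_def unit_deg_def)
  then have "{i, j} = {i', j'}"
    using assms(1) by metis
  then show ?thesis
    using assms(2,3) by (auto simp: doubleton_eq_iff)
qed

context kgraph
begin

text \<open>The identification of \<open>\<Lambda>\<^sup>0\<close> with the objects is automatic.\<close>

lemma vertices_eq: "vertices \<Lambda> = {x \<in> Mor \<Lambda>. rng \<Lambda> x = x}"
proof (intro equalityI subsetI)
  fix x assume "x \<in> vertices \<Lambda>"
  then have x: "x \<in> Mor \<Lambda>" "deg \<Lambda> x = (\<lambda>_. 0)"
    by (auto simp: vertices_def graded_def)
  let ?P = "\<lambda>(y, z). y \<in> graded \<Lambda> (\<lambda>_. 0) \<and> z \<in> graded \<Lambda> (\<lambda>_. 0) \<and>
    src \<Lambda> y = rng \<Lambda> z \<and> x = cmp \<Lambda> y z"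
  have "\<exists>!p. ?P p"
    using x factorisation[of x "\<lambda>_. 0" "\<lambda>_. 0"] by (simp add: degrees_def add_deg_def)
  moreover have "?P (rng \<Lambda> x, x)" "?P (x, src \<Lambda> x)"
    using x by (auto simp: graded_def rng_closed src_closed deg_identity rng_rng rng_src src_rng
        cmp_rng cmp_src)
  ultimately have "(rng \<Lambda> x, x) = (x, src \<Lambda> x)"
    by blast
  then show "x \<in> {x \<in> Mor \<Lambda>. rng \<Lambda> x = x}"
    using x by simp
qed (auto simp: vertices_def graded_def deg_identity)

lemma factors_unique:
  assumes "m \<in> degrees k" "n \<in> degrees k"
    and "y \<in> graded \<Lambda> m" "z \<in> graded \<Lambda> n" "src \<Lambda> y = rng \<Lambda> z"
    and "y' \<in> graded \<Lambda> m" "z' \<in> graded \<Lambda> n" "src \<Lambda> y' = rng \<Lambda> z'"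
    and "cmp \<Lambda> y z = cmp \<Lambda> y' z'"
  shows "y = y' \<and> z = z'"
proof -
  let ?P = "\<lambda>(a, b). a \<in> graded \<Lambda> m \<and> b \<in> graded \<Lambda> n \<and>
    src \<Lambda> a = rng \<Lambda> b \<and> cmp \<Lambda> y z = cmp \<Lambda> a b"
  have "cmp \<Lambda> y z \<in> Mor \<Lambda>" "deg \<Lambda> (cmp \<Lambda> y z) = add_deg m n"
    using assms(3-5) cmp_closed deg_cmp by (auto simp: graded_def)
  then have "\<exists>!p. ?P p"
    using factorisation assms(1,2) by simp
  moreover have "?P (y, z)" "?P (y', z')"
    using assms by auto
  ultimately have "(y, z) = (y', z')"
    by blast
  then show ?thesis
    by simp
qed

lemma square_factors_exist:
  assumes "x \<in> graded \<Lambda> (add_deg (unit_deg i) (unit_deg j))" "i \<in> {1..k}" "j \<in> {1..k}"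
  obtains f\<^sub>1 g\<^sub>1 f\<^sub>2 g\<^sub>2 where "square_factors \<Lambda> i j x f\<^sub>1 g\<^sub>1 f\<^sub>2 g\<^sub>2"
proof -
  have x: "x \<in> Mor \<Lambda>" "deg \<Lambda> x = add_deg (unit_deg i) (unit_deg j)"
    using assms(1) by (auto simp: graded_def)
  note d = unit_deg_degrees[OF assms(2)] unit_deg_degrees[OF assms(3)]
  obtain f g where "f \<in> graded \<Lambda> (unit_deg i)" "g \<in> graded \<Lambda> (unit_deg j)"
      "src \<Lambda> f = rng \<Lambda> g" "x = cmp \<Lambda> f g"
    using factorisation[OF x(1) d x(2)] by auto
  moreover obtain g' f' where "f' \<in> graded \<Lambda> (unit_deg i)" "g' \<in> graded \<Lambda> (unit_deg j)"
      "src \<Lambda> g' = rng \<Lambda> f'" "x = cmp \<Lambda> g' f'"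
    using factorisation[OF x(1) d(2,1)] x(2) add_deg_commute[of "unit_deg i"] by auto
  ultimately have "square_factors \<Lambda> i j x f g f' g'"
    by (simp add: square_factors_def)
  then show ?thesis
    using that by blast
qed

lemma square_boundary_eq:
  assumes "1 \<le> i" "i < j" "j \<le> k" "square_factors \<Lambda> i j x f\<^sub>1 g\<^sub>1 f\<^sub>2 g\<^sub>2"
  shows "square_boundary k \<Lambda> x = frag_of f\<^sub>1 + frag_of g\<^sub>1 - frag_of f\<^sub>2 - frag_of g\<^sub>2"
  unfolding square_boundary_def
proof (rule the_equality)
  fix c
  assume "\<exists>i j f\<^sub>1 g\<^sub>1 f\<^sub>2 g\<^sub>2. 1 \<le> i \<and> i < j \<and> j \<le> k \<and> square_factors \<Lambda> i j x f\<^sub>1 g\<^sub>1 f\<^sub>2 g\<^sub>2 \<and>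
    c = frag_of f\<^sub>1 + frag_of g\<^sub>1 - frag_of f\<^sub>2 - frag_of g\<^sub>2"
  then obtain i' j' a b a' b' where *: "1 \<le> i'" "i' < j'" "j' \<le> k"
    "square_factors \<Lambda> i' j' x a b a' b'" "c = frag_of a + frag_of b - frag_of a' - frag_of b'"
    by blast
  have "deg \<Lambda> x = add_deg (unit_deg i) (unit_deg j)"
    "deg \<Lambda> x = add_deg (unit_deg i') (unit_deg j')"
    using assms(4) *(4) deg_cmp[of f\<^sub>1 g\<^sub>1] deg_cmp[of a b]
    by (simp_all add: square_factors_def graded_def)
  then have ij: "i' = i" "j' = j"
    using add_unit_deg_inject assms(2) *(2) by metis+
  have d: "unit_deg i \<in> degrees k" "unit_deg j \<in> degrees k"
    using assms(1-3) by (auto intro: unit_deg_degrees)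
  have "a = f\<^sub>1 \<and> b = g\<^sub>1"
    using factors_unique[OF d, of a b f\<^sub>1 g\<^sub>1] assms(4) *(4) unfolding ij square_factors_def by auto
  moreover have "b' = g\<^sub>2 \<and> a' = f\<^sub>2"
    using factors_unique[OF d(2,1), of b' a' g\<^sub>2 f\<^sub>2] assms(4) *(4)
    unfolding ij square_factors_def by auto
  ultimately show "c = frag_of f\<^sub>1 + frag_of g\<^sub>1 - frag_of f\<^sub>2 - frag_of g\<^sub>2"
    using *(5) by simp
qed (use assms in blast)

lemma boundary1_boundary2:
  assumes "c \<in> carrier (C2 k \<Lambda>)"
  shows "boundary2 k \<Lambda> c \<in> carrier (C1 k \<Lambda>)" and "boundary1 \<Lambda> (boundary2 k \<Lambda> c) = 0"
proof -
  define X where "X = (\<Union>(i, j)\<in>{(i, j). 1 \<le> i \<and> i < j \<and> j \<le> k}.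
    graded \<Lambda> (add_deg (unit_deg i) (unit_deg j)))"
  have "Poly_Mapping.keys c \<subseteq> X"
    using assms by (simp add: C2_def free_Abelian_group_def X_def)
  moreover have "square_boundary k \<Lambda> x \<in> carrier (C1 k \<Lambda>) \<and>
      boundary1 \<Lambda> (square_boundary k \<Lambda> x) = 0" if xX: "x \<in> X" for x
  proof -
    obtain i j where ij: "1 \<le> i" "i < j" "j \<le> k"
      "x \<in> graded \<Lambda> (add_deg (unit_deg i) (unit_deg j))"
      using xX by (auto simp: X_def)
    then obtain f\<^sub>1 g\<^sub>1 f\<^sub>2 g\<^sub>2 where sf: "square_factors \<Lambda> i j x f\<^sub>1 g\<^sub>1 f\<^sub>2 g\<^sub>2"
      using square_factors_exist[of x i j] by (metis atLeastAtMost_iff less_imp_le order_trans)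
    note eq = square_boundary_eq[OF ij(1-3) sf]
    define E where "E = (\<Union>i\<in>{1..k}. graded \<Lambda> (unit_deg i))"
    have iE: "i \<in> {1..k}" "j \<in> {1..k}"
      using ij(1-3) by auto
    have inE: "f\<^sub>1 \<in> E" "f\<^sub>2 \<in> E" "g\<^sub>1 \<in> E" "g\<^sub>2 \<in> E"
      using sf iE unfolding E_def square_factors_def by blast+
    have "Poly_Mapping.keys (frag_of f\<^sub>1 + frag_of g\<^sub>1 - frag_of f\<^sub>2 - frag_of g\<^sub>2) \<subseteq> E"
      using inE by (auto simp: in_keys_iff lookup_add lookup_minus split: if_splits)
    moreover have "src \<Lambda> f\<^sub>1 = rng \<Lambda> g\<^sub>1" "src \<Lambda> g\<^sub>2 = rng \<Lambda> f\<^sub>2"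
      "rng \<Lambda> f\<^sub>1 = rng \<Lambda> g\<^sub>2" "src \<Lambda> g\<^sub>1 = src \<Lambda> f\<^sub>2"
      using sf rng_cmp[of f\<^sub>1 g\<^sub>1] rng_cmp[of g\<^sub>2 f\<^sub>2] src_cmp[of f\<^sub>1 g\<^sub>1] src_cmp[of g\<^sub>2 f\<^sub>2]
      unfolding square_factors_def graded_def by auto
    ultimately show ?thesis
      by (simp add: eq C1_def free_Abelian_group_def E_def boundary1_def frag_extend_add
          frag_extend_diff)
  qed
  ultimately have "boundary2 k \<Lambda> c \<in> carrier (C1 k \<Lambda>) \<and> boundary1 \<Lambda> (boundary2 k \<Lambda> c) = 0"
    unfolding boundary2_def
  proof (induction c rule: frag_induction)
    case (diff a b)
    then show ?case
      using keys_diff[of "frag_extend (square_boundary k \<Lambda>) a" "frag_extend (square_boundary k \<Lambda>) b"]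
      by (auto simp: frag_extend_diff boundary1_def C1_def free_Abelian_group_def)
  qed (auto simp: boundary1_def C1_def free_Abelian_group_def)
  then show "boundary2 k \<Lambda> c \<in> carrier (C1 k \<Lambda>)" and "boundary1 \<Lambda> (boundary2 k \<Lambda> c) = 0"
    by auto
qed

end

end

theory Submission
  imports Defs
begin

text \<open>
  A path from \<open>u\<close> to \<open>w\<close> is sent to its chain of signed edges; cancellations do not change the chain
  and commuting squares change it by the boundary of a square, so loops at \<open>v\<close> give a homomorphism
  \<open>\<pi>\<^sub>1(\<Lambda>, v) \<rightarrow> H\<^sub>1(\<Lambda>)\<close>. Choosing a path \<open>p\<^sub>u\<close> from \<open>v\<close> to every vertex \<open>u\<close>, one closes up each edge
  \<open>e\<close> to a loop \<open>p\<^sub>r e p\<^sub>s\<inverse>\<close>. The chain of this loop differs from \<open>e\<close> by a term that depends on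
  \<open>\<partial>e\<close> only, whence surjectivity. Conversely, sending \<open>e\<close> to the class of its loop defines a
  homomorphism \<open>\<theta>\<close> from \<open>C\<^sub>1(\<Lambda>)\<close> to the abelianisation of \<open>\<pi>\<^sub>1(\<Lambda>, v)\<close>, which recovers the class of a loop
  from its chain by telescoping and which kills \<open>Im \<partial>\<^sub>2\<close>; so the kernel of \<open>\<pi>\<^sub>1 \<rightarrow> H\<^sub>1\<close> is the derived
  subgroup.
\<close>

section \<open>Walks and their chains\<close>

text \<open>Both endpoints are arguments, so that inductions on the edge list can move the start
  vertex and keep the end fixed. The recursion \<open>walk_Cons\<close> then replaces reasoning
  about \<open>successively\<close>, \<open>hd\<close> and \<open>last\<close>.\<close>

definition walk :: "('v, 'e) digraph \<Rightarrow> 'v \<Rightarrow> 'e list \<Rightarrow> 'v \<Rightarrow> bool" where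
  "walk G u es w \<longleftrightarrow> (u, es) \<in> paths G \<and> path_source G (u, es) = w"

definition inverse_walk :: "'e uedge list \<Rightarrow> 'e uedge list" where
  "inverse_walk es = rev (map einv es)"

lemma inverse_walk_simps [simp]:
  "inverse_walk [] = []"
  "inverse_walk (e # es) = inverse_walk es @ [einv e]"
  "inverse_walk (es @ fs) = inverse_walk fs @ inverse_walk es"
  by (simp_all add: inverse_walk_def)

lemma einv_einv [simp]: "einv (einv e) = e"
  by (cases e) auto

lemma inverse_walk_inverse_walk [simp]: "inverse_walk (inverse_walk es) = es"
  by (induction es) auto

lemma path_category_sel [simp]:
  "Mor (path_category G) = paths G"
  "rng (path_category G) p = (fst p, [])"
  "src (path_category G) p = (path_source G p, [])"
  "cmp (path_category G) p q = (fst p, snd p @ snd q)"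
  by (simp_all add: path_category_def)

lemma path_source_Nil [simp]: "path_source G (u, []) = u"
  by (simp add: path_source_def)

text \<open>The record \<open>digraph\<close> does not force the endpoints of an edge to be
  vertices. With this condition only the empty walk has to mention \<open>verts\<close>, and the
  source of a path is again an object.\<close>

locale wf_graph =
  fixes G :: "('v, 'e) digraph"
  assumes erng_verts: "e \<in> edges G \<Longrightarrow> erng G e \<in> verts G"
    and esrc_verts: "e \<in> edges G \<Longrightarrow> esrc G e \<in> verts G"
begin

lemma walk_Nil [simp]: "walk G u [] w \<longleftrightarrow> u \<in> verts G \<and> w = u"
  by (auto simp: walk_def paths_def)

lemma walk_Cons [simp]:
  "walk G u (e # es) w \<longleftrightarrow> e \<in> edges G \<and> erng G e = u \<and> walk G (esrc G e) es w"
  by (cases es)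
    (auto simp: walk_def paths_def path_source_def successively_Cons erng_verts esrc_verts)

lemma walk_verts:
  assumes "walk G u es w"
  shows "u \<in> verts G" and "w \<in> verts G"
  using assms by (induction es arbitrary: u) (auto simp: erng_verts)

lemma walk_append: "walk G u (es @ fs) x \<longleftrightarrow> (\<exists>w. walk G u es w \<and> walk G w fs x)"
  by (induction es arbitrary: u) (auto dest: walk_verts)

lemma walk_appendI: "walk G u es w \<Longrightarrow> walk G w fs x \<Longrightarrow> walk G u (es @ fs) x"
  by (auto simp: walk_append)

lemma walk_path_source: "p \<in> paths G \<Longrightarrow> walk G (fst p) (snd p) (path_source G p)"
  by (simp add: walk_def)

lemma walk_source_unique: "walk G u es w \<Longrightarrow> walk G u es w' \<Longrightarrow> w = w'"
  by (simp add: walk_def)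

lemma category_path_category: "category (path_category G)"
proof
  fix f g
  assume "f \<in> Mor (path_category G)" "g \<in> Mor (path_category G)"
    "src (path_category G) f = rng (path_category G) g"
  then have "walk G (fst f) (snd f @ snd g) (path_source G g)"
    using walk_path_source[of f] walk_path_source[of g] by (auto intro: walk_appendI)
  then show "cmp (path_category G) f g \<in> Mor (path_category G)"
    "rng (path_category G) (cmp (path_category G) f g) = rng (path_category G) f"
    "src (path_category G) (cmp (path_category G) f g) = src (path_category G) g"
    by (simp_all add: walk_def)
next
  fix f
  assume "f \<in> Mor (path_category G)"
  then have "fst f \<in> verts G" "path_source G f \<in> verts G"
    using walk_path_source[of f] walk_verts by auto
  then show "rng (path_category G) f \<in> Mor (path_category G)"
    "src (path_category G) f \<in> Mor (path_category G)"
    by (auto simp: paths_def)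
qed auto

lemma wf_graph_undirected: "wf_graph (undirected G)"
  by standard (auto simp: undirected_def erng_verts esrc_verts)

end

lemma undirected_sel [simp]:
  "verts (undirected G) = verts G"
  "Fwd e \<in> edges (undirected G) \<longleftrightarrow> e \<in> edges G"
  "Bwd e \<in> edges (undirected G) \<longleftrightarrow> e \<in> edges G"
  "erng (undirected G) (Fwd e) = erng G e"
  "erng (undirected G) (Bwd e) = esrc G e"
  "esrc (undirected G) (Fwd e) = esrc G e"
  "esrc (undirected G) (Bwd e) = erng G e"
  by (auto simp: undirected_def)

lemma einv_undirected [simp]:
  "einv e \<in> edges (undirected G) \<longleftrightarrow> e \<in> edges (undirected G)"
  "erng (undirected G) (einv e) = esrc (undirected G) e"
  "esrc (undirected G) (einv e) = erng (undirected G) e"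
  by (cases e; simp)+

lemma (in wf_graph) walk_inverse:
  "walk (undirected G) u es w \<Longrightarrow> walk (undirected G) w (inverse_walk es) u"
proof (induction es arbitrary: u)
  interpret U: wf_graph "undirected G" by (rule wf_graph_undirected)
  {
    case Nil
    then show ?case by simp
  next
    case (Cons e es)
    then show ?case
      using U.erng_verts by (auto intro!: U.walk_appendI)
  }
qed

section \<open>Chains and boundaries of walks\<close>

lemma path_chain_simps [simp]:
  "path_chain (u, []) = 0"
  "path_chain (u, Fwd e # es) = frag_of e + path_chain (u, es)"
  "path_chain (u, Bwd e # es) = - frag_of e + path_chain (u, es)"
  by (simp_all add: path_chain_def)

text \<open>The chain depends on the edge list alone, so the vertices \<open>u\<close> and
  \<open>w\<close> are arbitrary. As \<open>w\<close> occurs only on the right, uses as a rewrite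
  rule instantiate it.\<close>

lemma path_chain_append: "path_chain (u, es @ fs) = path_chain (u, es) + path_chain (w, fs)"
  by (simp add: path_chain_def)

lemma path_chain_inverse_walk: "path_chain (u, inverse_walk es) = - path_chain (w, es)"
proof (induction es)
  case (Cons e es)
  then show ?case
    by (cases e) (simp_all add: path_chain_def)
qed simp

lemma (in wf_graph) keys_path_chain:
  "walk (undirected G) u es w \<Longrightarrow> Poly_Mapping.keys (path_chain (x :: 'v, es)) \<subseteq> edges G"
proof (induction es arbitrary: u)
  interpret U: wf_graph "undirected G" by (rule wf_graph_undirected)
  {
    case (Cons e es)
    then show ?case
      using keys_add[of "frag_of _" "path_chain (x, es)"] keys_add[of "- frag_of _" "path_chain (x, es)"]
      by (cases e) fastforce+
  }
qed simp

text \<open>This is \<open>boundary1\<close> for an arbitrary digraph; the two agree on the skeleton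
  by \<open>boundary1_eq\<close>.\<close>

definition graph_boundary :: "('v, 'e) digraph \<Rightarrow> ('e \<Rightarrow>\<^sub>0 int) \<Rightarrow> ('v \<Rightarrow>\<^sub>0 int)" where
  "graph_boundary G = frag_extend (\<lambda>e. frag_of (esrc G e) - frag_of (erng G e))"

text \<open>The sum telescopes: each signed edge contributes its end minus its start, also when
  traversed backwards. Hence closed walks have cycles as chains.\<close>

lemma (in wf_graph) graph_boundary_path_chain:
  "walk (undirected G) u es w \<Longrightarrow> graph_boundary G (path_chain (x :: 'v, es)) = frag_of w - frag_of u"
proof (induction es arbitrary: u)
  interpret U: wf_graph "undirected G" by (rule wf_graph_undirected)
  {
    case Nil
    then show ?case by (simp add: graph_boundary_def)
  next
    case (Cons e es)
    then show ?case
      by (cases e) (auto simp: graph_boundary_def frag_extend_add frag_extend_diff frag_extend_minus)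
  }
qed

section \<open>Vertex groups of quotient categories\<close>

locale category_congruence = category C for C :: "('a, 'b) cat_scheme" +
  fixes T :: "('a \<times> 'a) set"
  assumes congruence: "congruence C T"
begin

lemma equiv: "equiv (Mor C) T"
  using congruence by (simp add: congruence_def)

lemma class_eq_iff:
  "f \<in> Mor C \<Longrightarrow> g \<in> Mor C \<Longrightarrow> T `` {f} = T `` {g} \<longleftrightarrow> (f, g) \<in> T"
  by (rule eq_equiv_class_iff[OF equiv])

lemma cong_endpoints: "(f, g) \<in> T \<Longrightarrow> rng C f = rng C g \<and> src C f = src C g"
  using congruence by (auto simp: congruence_def)

lemma cong_cmp: "(f, f') \<in> T \<Longrightarrow> (g, g') \<in> T \<Longrightarrow> src C f = rng C g \<Longrightarrow> (cmp C f g, cmp C f' g') \<in> T"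
  using congruence unfolding congruence_def by blast

lemma cong_refl: "f \<in> Mor C \<Longrightarrow> (f, f) \<in> T"
  using equiv by (auto simp: equiv_def refl_on_def)

lemma cong_trans: "(f, g) \<in> T \<Longrightarrow> (g, h) \<in> T \<Longrightarrow> (f, h) \<in> T"
  using equiv by (auto simp: equiv_def dest: transD)

lemma Mor_quotient: "Mor (quotient_category C T) = (\<lambda>f. T `` {f}) ` Mor C"
  by (auto simp: quotient_category_def quotient_def)

text \<open>The operations of \<open>quotient_category\<close> are unions over all representatives.
  Such a union collapses to one value once the value is constant on the class, which is nonempty by
  reflexivity.\<close>

lemma class_union_const:
  assumes "f \<in> Mor C" and "\<And>g. (f, g) \<in> T \<Longrightarrow> F g = c"
  shows "(\<Union>g\<in>T `` {f}. F g) = c"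
  using cong_refl[OF assms(1)] assms(2) by (intro SUP_eq_const) auto

lemma rng_quotient: "f \<in> Mor C \<Longrightarrow> rng (quotient_category C T) (T `` {f}) = T `` {rng C f}"
  unfolding quotient_category_def by (simp, rule class_union_const) (auto dest: cong_endpoints)

lemma src_quotient: "f \<in> Mor C \<Longrightarrow> src (quotient_category C T) (T `` {f}) = T `` {src C f}"
  unfolding quotient_category_def by (simp, rule class_union_const) (auto dest: cong_endpoints)

lemma cmp_quotient:
  assumes "f \<in> Mor C" "g \<in> Mor C" "src C f = rng C g"
  shows "cmp (quotient_category C T) (T `` {f}) (T `` {g}) = T `` {cmp C f g}"
proof -
  have "T `` {cmp C f' g'} = T `` {cmp C f g}" if "(f, f') \<in> T" "(g, g') \<in> T" for f' g'
    using equiv_class_eq[OF equiv cong_cmp[OF that assms(3)]] by simp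
  then have "(\<Union>f'\<in>T `` {f}. \<Union>g'\<in>T `` {g}. T `` {cmp C f' g'}) = T `` {cmp C f g}"
    by (intro class_union_const assms(1,2))
  then show ?thesis
    by (simp add: quotient_category_def)
qed

definition loops :: "'a \<Rightarrow> 'a set" where
  "loops u = {f \<in> Mor C. rng C f = u \<and> src C f = u}"

text \<open>A congruence preserves endpoints, so distinct objects have distinct classes. A class is
  therefore a loop at the class of \<open>u\<close> exactly when its representatives are loops at
  \<open>u\<close> itself.\<close>

lemma carrier_vertex_group_quotient:
  assumes "u \<in> Mor C" "rng C u = u"
  shows "carrier (vertex_group (quotient_category C T) (T `` {u})) = (\<lambda>f. T `` {f}) ` loops u"
proof -
  have "T `` {w} = T `` {u} \<longleftrightarrow> w = u" if "w \<in> Mor C" "rng C w = w" for w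
    using that class_eq_iff[of w u] cong_endpoints[of w u] assms cong_refl by auto
  then have "T `` {rng C f} = T `` {u} \<longleftrightarrow> rng C f = u"
    "T `` {src C f} = T `` {u} \<longleftrightarrow> src C f = u" if "f \<in> Mor C" for f
    using that by (simp_all add: rng_closed src_closed rng_rng rng_src)
  then show ?thesis
    unfolding vertex_group_def loops_def
    by (auto simp: Mor_quotient rng_quotient src_quotient)
qed

lemma mult_vertex_group_quotient:
  assumes "f \<in> loops u" "g \<in> loops u"
  shows "(T `` {f}) \<otimes>\<^bsub>vertex_group (quotient_category C T) (T `` {u})\<^esub> (T `` {g}) = T `` {cmp C f g}"
  using assms cmp_quotient by (simp add: vertex_group_def loops_def)

lemma cmp_loops: "f \<in> loops u \<Longrightarrow> g \<in> loops u \<Longrightarrow> cmp C f g \<in> loops u"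
  by (simp add: loops_def cmp_closed rng_cmp src_cmp)

text \<open>Associativity and unit laws descend from the category. Left inverses need to exist only
  up to \<open>T\<close>, which is what cancellation of an edge against its inverse will
  provide.\<close>

lemma group_vertex_group_quotient:
  assumes "u \<in> Mor C" "rng C u = u"
    and inv: "\<And>f. f \<in> loops u \<Longrightarrow> \<exists>g\<in>loops u. (cmp C g f, u) \<in> T"
  shows "group (vertex_group (quotient_category C T) (T `` {u}))" (is "group ?V")
proof -
  note carrier = carrier_vertex_group_quotient[OF assms(1,2)]
  have u: "u \<in> loops u"
    using assms(1,2) src_rng[of u] by (simp add: loops_def)
  have one: "\<one>\<^bsub>?V\<^esub> = T `` {u}"
    by (simp add: vertex_group_def)
  show ?thesis
  proof (rule groupI)
    show "x \<otimes>\<^bsub>?V\<^esub> y \<in> carrier ?V" if "x \<in> carrier ?V" "y \<in> carrier ?V" for x y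
      using that by (auto simp: carrier mult_vertex_group_quotient cmp_loops)
    show "\<one>\<^bsub>?V\<^esub> \<in> carrier ?V"
      using u by (auto simp: carrier one)
    show "x \<otimes>\<^bsub>?V\<^esub> y \<otimes>\<^bsub>?V\<^esub> z = x \<otimes>\<^bsub>?V\<^esub> (y \<otimes>\<^bsub>?V\<^esub> z)"
      if xyz_carrier: "x \<in> carrier ?V" "y \<in> carrier ?V" "z \<in> carrier ?V" for x y z
    proof -
      obtain f g h where "f \<in> loops u" "g \<in> loops u" "h \<in> loops u"
        and xyz: "x = T `` {f}" "y = T `` {g}" "z = T `` {h}"
        using xyz_carrier by (auto simp: carrier)
      moreover from this have "cmp C (cmp C f g) h = cmp C f (cmp C g h)"
        by (simp add: loops_def cmp_assoc)
      ultimately show ?thesis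
        by (simp add: mult_vertex_group_quotient cmp_loops)
    qed
    show "\<one>\<^bsub>?V\<^esub> \<otimes>\<^bsub>?V\<^esub> x = x" if "x \<in> carrier ?V" for x
    proof -
      obtain f where f: "f \<in> loops u" "x = T `` {f}"
        using \<open>x \<in> carrier ?V\<close> by (auto simp: carrier)
      then have "cmp C u f = f"
        using cmp_rng[of f] by (auto simp: loops_def)
      then show ?thesis
        using f u by (simp add: one mult_vertex_group_quotient)
    qed
    show "\<exists>y\<in>carrier ?V. y \<otimes>\<^bsub>?V\<^esub> x = \<one>\<^bsub>?V\<^esub>" if "x \<in> carrier ?V" for x
    proof -
      obtain f where f: "f \<in> loops u" "x = T `` {f}"
        using \<open>x \<in> carrier ?V\<close> by (auto simp: carrier)
      then obtain g where g: "g \<in> loops u" "(cmp C g f, u) \<in> T"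
        using inv by blast
      then show ?thesis
        using f equiv_class_eq[OF equiv g(2)]
        by (auto simp: carrier one mult_vertex_group_quotient intro!: bexI[of _ g])
    qed
  qed
qed

end

section \<open>Undirected paths up to homotopy\<close>

text \<open>Cancellation makes the quotient a groupoid. The commuting squares enter when
  \<open>T\<close> is instantiated with \<open>homotopy\<close>.\<close>

locale undirected_congruence = wf_graph G for G :: "('v, 'e) digraph" +
  fixes T :: "(('v \<times> 'e uedge list) \<times> ('v \<times> 'e uedge list)) set"
  assumes undirected_congruence: "congruence (path_category (undirected G)) T"
    and cancel_rel_subset: "cancel_rel G \<subseteq> T"
begin

sublocale U: wf_graph "undirected G"
  by (rule wf_graph_undirected)

sublocale category_congruence "path_category (undirected G)" T
  by (intro category_congruence.intro U.category_path_category category_congruence_axioms.intro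
      undirected_congruence)

abbreviation homotopic :: "'v \<Rightarrow> 'e uedge list \<Rightarrow> 'e uedge list \<Rightarrow> bool" where
  "homotopic u es fs \<equiv> ((u, es), (u, fs)) \<in> T"

lemma homotopic_refl: "walk (undirected G) u es w \<Longrightarrow> homotopic u es es"
  by (rule cong_refl) (simp add: walk_def)

lemma homotopic_append:
  assumes "homotopic u es es'" "homotopic w fs fs'" "walk (undirected G) u es w"
  shows "homotopic u (es @ fs) (es' @ fs')"
  using cong_cmp[OF assms(1,2)] assms(3) by (simp add: walk_def)

text \<open>Rewriting inside a path: the middle segment is replaced and both ends stay
  fixed.\<close>

lemma homotopic_context:
  assumes "walk (undirected G) u as w" "homotopic w es fs" "walk (undirected G) w es x"
    "walk (undirected G) x bs y"
  shows "homotopic u (as @ es @ bs) (as @ fs @ bs)"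
  using assms by (intro homotopic_append homotopic_refl) auto

text \<open>The word is contracted from the inside: the induction hypothesis removes the inner part
  between \<open>e\<close> and its inverse, and the remaining outer pair cancels.\<close>

lemma homotopic_inverse_right:
  assumes "walk (undirected G) u es w"
  shows "homotopic u (es @ inverse_walk es) []"
  using assms
proof (induction es arbitrary: u)
  case Nil
  then show ?case
    by (simp add: homotopic_refl)
next
  case (Cons e es)
  let ?w = "esrc (undirected G) e"
  have e: "e \<in> edges (undirected G)" "erng (undirected G) e = u" "walk (undirected G) ?w es w"
    using Cons.prems by simp_all
  have u: "u \<in> verts G"
    using U.erng_verts e by fastforce
  have w: "?w \<in> verts G"
    using U.esrc_verts e by fastforce
  have "homotopic u ([e] @ (es @ inverse_walk es) @ [einv e]) ([e] @ [] @ [einv e])"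
    using Cons.IH[OF e(3)] e u w walk_inverse
    by (intro homotopic_context[of _ _ ?w _ _ ?w _ u]) (auto intro!: U.walk_appendI)
  moreover have "homotopic u [e, einv e] []"
  proof -
    \<comment> \<open>\<open>cancel_rel\<close> only lists pairs with the inverse edge first; the
      opposite order is its instance at \<open>einv e\<close>.\<close>
    have "((esrc (undirected G) (einv e), [einv (einv e), einv e]),
        (esrc (undirected G) (einv e), [])) \<in> cancel_rel G"
      using e(1) unfolding cancel_rel_def by (intro CollectI exI[of _ "einv e"]) simp
    then show ?thesis
      using cancel_rel_subset e(2) by auto
  qed
  ultimately show ?case
    using cong_trans by fastforce
qed

lemma homotopic_inverse_left:
  assumes "walk (undirected G) u es w"
  shows "homotopic w (inverse_walk es @ es) []"
  using homotopic_inverse_right[OF walk_inverse[OF assms]] by simp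

lemma loops_iff: "h \<in> loops (v, []) \<longleftrightarrow> (\<exists>es. h = (v, es) \<and> walk (undirected G) v es v)"
  by (cases h) (auto simp: loops_def walk_def)

abbreviation fundamental :: "'v \<Rightarrow> ('v \<times> 'e uedge list) set monoid" where
  "fundamental v \<equiv> vertex_group (quotient_category (path_category (undirected G)) T) (T `` {(v, [])})"

lemma carrier_fundamental:
  assumes "v \<in> verts G"
  shows "carrier (fundamental v) = {T `` {(v, es)} | es. walk (undirected G) v es v}"
  using carrier_vertex_group_quotient[of "(v, [])"] assms
  by (auto simp: loops_iff image_iff paths_def)

lemma mult_fundamental:
  assumes "walk (undirected G) v es v" "walk (undirected G) v fs v"
  shows "(T `` {(v, es)}) \<otimes>\<^bsub>fundamental v\<^esub> (T `` {(v, fs)}) = T `` {(v, es @ fs)}"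
  using mult_vertex_group_quotient[of "(v, es)" "(v, []) " "(v, fs)"] assms by (simp add: loops_iff)

lemma group_fundamental:
  assumes "v \<in> verts G"
  shows "group (fundamental v)"
proof (rule group_vertex_group_quotient)
  fix f assume "f \<in> loops (v, [])"
  then obtain es where es: "f = (v, es)" "walk (undirected G) v es v"
    by (auto simp: loops_iff)
  then show "\<exists>g\<in>loops (v, []). (cmp (path_category (undirected G)) g f, (v, [])) \<in> T"
    using walk_inverse homotopic_inverse_left
    by (intro bexI[of _ "(v, inverse_walk es)"]) (auto simp: loops_iff)
qed (use assms in \<open>auto simp: paths_def\<close>)

lemma one_fundamental: "\<one>\<^bsub>fundamental v\<^esub> = T `` {(v, [])}"
  by (simp add: vertex_group_def)

lemma homotopic_class_eq: "homotopic u es fs \<Longrightarrow> T `` {(u, es)} = T `` {(u, fs)}"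
  by (rule equiv_class_eq[OF equiv])

lemma inv_fundamental:
  assumes "walk (undirected G) v es v"
  shows "inv\<^bsub>fundamental v\<^esub> (T `` {(v, es)}) = T `` {(v, inverse_walk es)}"
proof -
  have v: "v \<in> verts G"
    using U.walk_verts[OF assms] by simp
  note i = walk_inverse[OF assms]
  show ?thesis
  proof (rule group.inv_equality[OF group_fundamental[OF v]])
    show "T `` {(v, inverse_walk es)} \<otimes>\<^bsub>fundamental v\<^esub> T `` {(v, es)} = \<one>\<^bsub>fundamental v\<^esub>"
      using homotopic_class_eq[OF homotopic_inverse_left[OF assms]]
      by (simp add: mult_fundamental assms i one_fundamental)
  qed (use assms i carrier_fundamental[OF v] in auto)
qed

end

section \<open>Loops through a base vertex\<close>

locale based_connections = undirected_congruence G T for G :: "('v, 'e) digraph" and T +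
  fixes v :: 'v and p :: "'v \<Rightarrow> 'e uedge list"
  assumes base: "v \<in> verts G"
    and walk_p: "u \<in> verts G \<Longrightarrow> walk (undirected G) v (p u) u"
begin

sublocale group "fundamental v"
  by (rule group_fundamental[OF base])

text \<open>The chosen walks \<open>p\<close> play the role of a spanning tree, but
  \<open>p v\<close> may be a nontrivial loop. Closing up a loop at \<open>v\<close> thus conjugates
  it by \<open>p v\<close>.\<close>

definition close_up :: "'v \<Rightarrow> 'e uedge list \<Rightarrow> 'v \<Rightarrow> 'e uedge list" where
  "close_up u es w = p u @ es @ inverse_walk (p w)"

lemma walk_close_up:
  assumes "walk (undirected G) u es w"
  shows "walk (undirected G) v (close_up u es w) v"
  unfolding close_up_def
  by (intro U.walk_appendI[OF walk_p] U.walk_appendI[OF assms] walk_inverse[OF walk_p]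
      U.walk_verts[OF assms, simplified])

text \<open>Let P be the linear extension of the chains of the walks \<open>p u\<close>. Closing up
  an edge \<open>e\<close> gives the chain e - (P(s(e)) - P(r(e))), that is, e minus P of the
  boundary of e. Both sides are additive, with differences realised by concatenating a loop with the
  reverse of another. For a cycle the correction vanishes.\<close>

lemma chain_of_loop:
  assumes "Poly_Mapping.keys c \<subseteq> edges G"
  shows "\<exists>es. walk (undirected G) v es v \<and>
    path_chain (v, es) = c - frag_extend (\<lambda>u. path_chain (v, p u)) (graph_boundary G c)"
    (is "\<exists>es. ?P es c")
  using assms
proof (induction c rule: frag_induction)
  case zero
  show ?case
    using base by (intro exI[of _ "[]"]) (simp add: graph_boundary_def)
next
  case (one e)
  have "walk (undirected G) (erng G e) [Fwd e] (esrc G e)"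
    using one esrc_verts by simp
  then have "?P (close_up (erng G e) [Fwd e] (esrc G e)) (frag_of e)"
    using walk_close_up[of "erng G e" "[Fwd e]" "esrc G e"]
    by (simp add: close_up_def path_chain_append[of _ _ _ v] path_chain_inverse_walk[of _ _ v]
        graph_boundary_def frag_extend_diff)
  then show ?case ..
next
  case (diff a b)
  then obtain es fs where *: "?P es a" "?P fs b"
    by blast
  have "?P (es @ inverse_walk fs) (a - b)"
    using * walk_inverse
    by (auto intro: U.walk_appendI simp: path_chain_append[of _ _ _ v] path_chain_inverse_walk[of _ _ v]
        graph_boundary_def frag_extend_diff)
  then show ?case ..
qed

text \<open>The inverse of \<open>p w\<close> that ends the first loop cancels against the
  \<open>p w\<close> that starts the second.\<close>

lemma homotopic_close_up_append:
  assumes "walk (undirected G) u es w" "walk (undirected G) w fs x"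
  shows "homotopic v (close_up u es w @ close_up w fs x) (close_up u (es @ fs) x)"
proof -
  have "u \<in> verts G" "w \<in> verts G" "x \<in> verts G"
    using assms U.walk_verts by auto
  then have "homotopic v ((p u @ es) @ (inverse_walk (p w) @ p w) @ (fs @ inverse_walk (p x)))
      ((p u @ es) @ [] @ (fs @ inverse_walk (p x)))"
    using assms
    by (intro homotopic_context[of _ _ w _ _ w _ v] homotopic_inverse_left[of v] U.walk_appendI[of _ _ u]
        U.walk_appendI[of _ _ x] U.walk_appendI[of _ _ v] walk_inverse walk_p)
  then show ?thesis
    by (simp add: close_up_def)
qed

text \<open>The universal property of the free abelian group defines \<open>\<theta>\<close> on
  edges by the classes of the closed-up loops. The formula extends to walks edge by edge, because
  closed-up pieces compose up to homotopy.\<close>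

lemma path_chain_hom:
  assumes "comm_group A" "q \<in> hom (fundamental v) A"
  obtains \<theta> where "\<theta> \<in> hom (free_Abelian_group (edges G)) A"
    and "\<And>u es w. walk (undirected G) u es w \<Longrightarrow>
      \<theta> (path_chain (u, es)) = q (T `` {(v, close_up u es w)})"
proof -
  interpret A: comm_group A by fact
  interpret q: group_hom "fundamental v" A q
    using assms(2) by (simp add: group_hom_def group_hom_axioms_def is_group A.is_group)
  let ?F = "free_Abelian_group (edges G)"
  let ?l = "\<lambda>e. close_up (erng G e) [Fwd e] (esrc G e)"
  have walk_l: "walk (undirected G) v (?l e) v" if "e \<in> edges G" for e
    using that esrc_verts by (intro walk_close_up) simp
  then have "(\<lambda>e. q (T `` {(v, ?l e)})) ` edges G \<subseteq> carrier A"
    using carrier_fundamental[OF base] by (auto intro!: q.hom_closed)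
  then obtain \<theta> where \<theta>: "\<theta> \<in> hom ?F A"
    and \<theta>_edge: "\<And>e. e \<in> edges G \<Longrightarrow> \<theta> (frag_of e) = q (T `` {(v, ?l e)})"
    by (rule A.free_Abelian_group_universal) blast
  interpret \<theta>: group_hom ?F A \<theta>
    using \<theta> by (simp add: group_hom_def group_hom_axioms_def A.is_group)
  have single: "\<theta> (path_chain (u, [e])) = q (T `` {(v, close_up u [e] w)})"
    if "walk (undirected G) u [e] w" for u e w
  proof (cases e)
    case (Fwd d)
    then show ?thesis
      using that \<theta>_edge by auto
  next
    \<comment> \<open>The loop closed up from \<open>Bwd d\<close> is literally the reverse of the
      one closed up from \<open>Fwd d\<close>, so both sides are inverses of the values at
      \<open>d\<close>.\<close>
    case (Bwd d)
    then have d: "d \<in> edges G" "u = esrc G d" "w = erng G d"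
      using that by auto
    have "\<theta> (- frag_of d) = inv\<^bsub>A\<^esub> \<theta> (frag_of d)"
      using \<theta>.hom_inv[of "frag_of d"] d by simp
    also have "\<dots> = q (inv\<^bsub>fundamental v\<^esub> (T `` {(v, ?l d)}))"
      using \<theta>_edge d walk_l[OF d(1)] carrier_fundamental[OF base] by (subst q.hom_inv) auto
    also have "inv\<^bsub>fundamental v\<^esub> (T `` {(v, ?l d)}) = T `` {(v, close_up u [e] w)}"
      using inv_fundamental[OF walk_l[OF d(1)]] d Bwd by (simp add: close_up_def)
    finally show ?thesis
      by (simp add: Bwd)
  qed
  have "\<theta> (path_chain (u, es)) = q (T `` {(v, close_up u es w)})"
    if "walk (undirected G) u es w" for u es w
    using that
  proof (induction es arbitrary: u)
    case Nil
    then have "walk (undirected G) v (p u) u" "w = u"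
      using walk_p by auto
    then have "T `` {(v, close_up u [] w)} = \<one>\<^bsub>fundamental v\<^esub>"
      using homotopic_class_eq[OF homotopic_inverse_right] by (simp add: close_up_def one_fundamental)
    then show ?case
      using \<theta>.hom_one q.hom_one by simp
  next
    case (Cons e es)
    let ?x = "esrc (undirected G) e"
    have walks: "walk (undirected G) u [e] ?x" "walk (undirected G) ?x es w"
      using Cons.prems U.esrc_verts by auto
    have "\<theta> (path_chain (u, e # es)) = \<theta> (path_chain (u, [e]) + path_chain (?x, es))"
      using path_chain_append[of u "[e]" es ?x] by simp
    also have "\<dots> = \<theta> (path_chain (u, [e])) \<otimes>\<^bsub>A\<^esub> \<theta> (path_chain (?x, es))"
      using keys_path_chain[OF walks(1), of u] keys_path_chain[OF walks(2), of ?x]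
        \<theta>.hom_mult[of "path_chain (u, [e])" "path_chain (?x, es)"] by simp
    also have "\<dots> = q (T `` {(v, close_up u [e] ?x)}) \<otimes>\<^bsub>A\<^esub> q (T `` {(v, close_up ?x es w)})"
      using single[OF walks(1)] Cons.IH[OF walks(2)] by simp
    also have "\<dots> = q (T `` {(v, close_up u [e] ?x @ close_up ?x es w)})"
      using walk_close_up[OF walks(1)] walk_close_up[OF walks(2)] carrier_fundamental[OF base]
      by (subst q.hom_mult[symmetric]) (auto simp: mult_fundamental)
    also have "\<dots> = q (T `` {(v, close_up u (e # es) w)})"
      using homotopic_class_eq[OF homotopic_close_up_append[OF walks]] by simp
    finally show ?case .
  qed
  then show ?thesis
    using that \<theta> by blast
qed

text \<open>Closing up a loop at \<open>v\<close> conjugates its class by that of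
  \<open>p v\<close>, which is invisible in the commutative group \<open>A\<close>.\<close>

lemma class_close_up_loop:
  assumes "comm_group A" "q \<in> hom (fundamental v) A" "walk (undirected G) v es v"
  shows "q (T `` {(v, close_up v es v)}) = q (T `` {(v, es)})"
proof -
  interpret A: comm_group A by fact
  interpret q: group_hom "fundamental v" A q
    using assms(2) by (simp add: group_hom_def group_hom_axioms_def is_group A.is_group)
  let ?c = "\<lambda>es. T `` {(v, es)}"
  have p: "walk (undirected G) v (p v) v"
    using walk_p base by blast
  have in_carrier: "?c fs \<in> carrier (fundamental v)" if "walk (undirected G) v fs v" for fs
    using that carrier_fundamental[OF base] by auto
  have "?c (close_up v es v) = ?c (p v) \<otimes>\<^bsub>fundamental v\<^esub> ?c es \<otimes>\<^bsub>fundamental v\<^esub> inv\<^bsub>fundamental v\<^esub> ?c (p v)"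
    using p assms(3) walk_inverse[OF p]
    by (simp add: close_up_def inv_fundamental mult_fundamental U.walk_appendI)
  then have "q (?c (close_up v es v)) = q (?c (p v)) \<otimes>\<^bsub>A\<^esub> q (?c es) \<otimes>\<^bsub>A\<^esub> inv\<^bsub>A\<^esub> q (?c (p v))"
    using in_carrier p assms(3) by simp
  then show ?thesis
    using in_carrier p assms(3) A.m_comm A.inv_solve_right' by (simp add: A.m_assoc A.m_lcomm)
qed

end

section \<open>Homotopy and homology of higher-rank graphs\<close>

lemma skeleton_sel [simp]:
  "verts (skeleton k \<Lambda>) = vertices \<Lambda>"
  "edges (skeleton k \<Lambda>) = (\<Union>i\<in>{1..k}. graded \<Lambda> (unit_deg i))"
  "erng (skeleton k \<Lambda>) = rng \<Lambda>"
  "esrc (skeleton k \<Lambda>) = src \<Lambda>"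
  by (simp_all add: skeleton_def)

context kgraph
begin

lemma wf_graph_skeleton: "wf_graph (skeleton k \<Lambda>)"
  by standard (auto simp: graded_def vertices_eq rng_closed src_closed rng_rng rng_src)

sublocale skel: wf_graph "skeleton k \<Lambda>"
  by (rule wf_graph_skeleton)

sublocale uskel: wf_graph "undirected (skeleton k \<Lambda>)"
  by (rule skel.wf_graph_undirected)

lemma walk_map_Fwd: "walk (skeleton k \<Lambda>) u es w \<Longrightarrow> walk (undirected (skeleton k \<Lambda>)) u (map Fwd es) w"
  by (induction es arbitrary: u) auto

section \<open>Commuting squares and boundaries\<close>

definition squares :: "'a set" where
  "squares = (\<Union>(i, j)\<in>{(i, j). 1 \<le> i \<and> i < j \<and> j \<le> k}.
     graded \<Lambda> (add_deg (unit_deg i) (unit_deg j)))"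

lemma carrier_C2: "c \<in> carrier (C2 k \<Lambda>) \<longleftrightarrow> Poly_Mapping.keys c \<subseteq> squares"
  by (simp add: C2_def squares_def)

lemma B1_diff: "a \<in> B1 k \<Lambda> \<Longrightarrow> b \<in> B1 k \<Lambda> \<Longrightarrow> a - b \<in> B1 k \<Lambda>"
proof -
  assume "a \<in> B1 k \<Lambda>" "b \<in> B1 k \<Lambda>"
  then obtain a' b' where *: "a = boundary2 k \<Lambda> a'" "b = boundary2 k \<Lambda> b'"
    "Poly_Mapping.keys a' \<subseteq> squares" "Poly_Mapping.keys b' \<subseteq> squares"
    by (auto simp: B1_def carrier_C2)
  then show "a - b \<in> B1 k \<Lambda>"
    using keys_diff[of a' b'] unfolding B1_def
    by (intro image_eqI[of _ _ "a' - b'"]) (auto simp: carrier_C2 boundary2_def frag_extend_diff)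
qed

lemma B1_zero: "0 \<in> B1 k \<Lambda>"
  unfolding B1_def by (intro image_eqI[of _ _ 0]) (auto simp: carrier_C2 boundary2_def)

lemma B1_minus: "a \<in> B1 k \<Lambda> \<Longrightarrow> - a \<in> B1 k \<Lambda>"
  using B1_diff[OF B1_zero] by simp

lemma B1_add: "a \<in> B1 k \<Lambda> \<Longrightarrow> b \<in> B1 k \<Lambda> \<Longrightarrow> a + b \<in> B1 k \<Lambda>"
  using B1_diff[of a "- b"] B1_minus by simp

lemma square_boundary_in_B1: "x \<in> squares \<Longrightarrow> square_boundary k \<Lambda> x \<in> B1 k \<Lambda>"
  unfolding B1_def by (intro image_eqI[of _ _ "frag_of x"]) (auto simp: carrier_C2 boundary2_def)

lemma square_factors_boundary_in_B1:
  assumes "1 \<le> i" "i < j" "j \<le> k" "square_factors \<Lambda> i j x f\<^sub>1 g\<^sub>1 f\<^sub>2 g\<^sub>2"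
  shows "frag_of f\<^sub>1 + frag_of g\<^sub>1 - frag_of f\<^sub>2 - frag_of g\<^sub>2 \<in> B1 k \<Lambda>"
proof -
  have "x \<in> graded \<Lambda> (add_deg (unit_deg i) (unit_deg j))"
    using assms(4) deg_cmp[of f\<^sub>1 g\<^sub>1] cmp_closed[of f\<^sub>1 g\<^sub>1] by (auto simp: square_factors_def graded_def)
  then have "x \<in> squares"
    using assms(1-3) by (auto simp: squares_def)
  then show ?thesis
    using square_boundary_in_B1[of x] square_boundary_eq[OF assms] by simp
qed

text \<open>The two sides of a square are parallel paths, and the difference of their chains is the
  boundary of the square up to a sign that depends on which of the two degrees comes first. The
  vertex \<open>x\<close> is arbitrary, as chains ignore it.\<close>

lemma commuting_squares_boundary:
  assumes "(s, s') \<in> commuting_squares k \<Lambda>"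
  obtains u w where "walk (skeleton k \<Lambda>) u (snd s) w" "walk (skeleton k \<Lambda>) u (snd s') w"
    "fst s = u" "fst s' = u"
    "path_chain (x, map Fwd (snd s)) - path_chain (x, map Fwd (snd s')) \<in> B1 k \<Lambda>"
proof -
  obtain i j f g f' g' where ij: "i \<in> {1..k}" "j \<in> {1..k}" "i \<noteq> j"
    and s: "s = (rng \<Lambda> f, [f, g])" "s' = (rng \<Lambda> g', [g', f'])"
    and sq: "f \<in> graded \<Lambda> (unit_deg i)" "f' \<in> graded \<Lambda> (unit_deg i)"
      "g \<in> graded \<Lambda> (unit_deg j)" "g' \<in> graded \<Lambda> (unit_deg j)"
      "src \<Lambda> f = rng \<Lambda> g" "src \<Lambda> g' = rng \<Lambda> f'" "cmp \<Lambda> f g = cmp \<Lambda> g' f'"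
    using assms unfolding commuting_squares_def by blast
  have Mor: "f \<in> Mor \<Lambda>" "g \<in> Mor \<Lambda>" "f' \<in> Mor \<Lambda>" "g' \<in> Mor \<Lambda>"
    using sq by (auto simp: graded_def)
  have ends: "rng \<Lambda> f = rng \<Lambda> g'" "src \<Lambda> g = src \<Lambda> f'"
    using sq Mor rng_cmp[of f g] rng_cmp[of g' f'] src_cmp[of f g] src_cmp[of g' f'] by simp_all
  have verts: "src \<Lambda> g \<in> vertices \<Lambda>"
    using Mor by (simp add: vertices_eq src_closed rng_src)
  have "frag_of f + frag_of g - (frag_of g' + frag_of f') \<in> B1 k \<Lambda>"
  proof (cases "i < j")
    case True
    then have "square_factors \<Lambda> i j (cmp \<Lambda> f g) f g f' g'"
      using sq by (simp add: square_factors_def)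
    from square_factors_boundary_in_B1[OF _ True _ this] show ?thesis
      using ij by (simp add: algebra_simps)
  next
    case False
    then have ji: "j < i"
      using ij by simp
    \<comment> \<open>The boundary is defined with the smaller index first, so the square is read
      from its other side, which reverses the sign.\<close>
    have "square_factors \<Lambda> j i (cmp \<Lambda> f g) g' f' g f"
      using sq by (simp add: square_factors_def)
    from B1_minus[OF square_factors_boundary_in_B1[OF _ ji _ this]] show ?thesis
      using ij by (simp add: algebra_simps)
  qed
  then have "path_chain (x, map Fwd (snd s)) - path_chain (x, map Fwd (snd s')) \<in> B1 k \<Lambda>"
    by (simp add: s)
  moreover have "walk (skeleton k \<Lambda>) (rng \<Lambda> f) [f, g] (src \<Lambda> g)"
    "walk (skeleton k \<Lambda>) (rng \<Lambda> f) [g', f'] (src \<Lambda> g)"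
    using ij sq ends verts by auto
  ultimately show ?thesis
    using that[of "rng \<Lambda> f" "src \<Lambda> g"] ends s by simp
qed

text \<open>The common prefix and suffix drop out of the difference of the chains, leaving that of
  the two sides of the square.\<close>

lemma square_step_boundary:
  assumes "square_step k \<Lambda> p q"
  shows "fst p = fst q" "path_source (skeleton k \<Lambda>) p = path_source (skeleton k \<Lambda>) q"
    "path_chain (x, map Fwd (snd p)) - path_chain (x, map Fwd (snd q)) \<in> B1 k \<Lambda>"
proof -
  let ?G = "skeleton k \<Lambda>"
  obtain a b s s' where ab: "a \<in> paths ?G" "b \<in> paths ?G" and ss: "(s, s') \<in> commuting_squares k \<Lambda>"
    and comp: "path_source ?G a = fst s" "path_source ?G s = fst b"
    and pq: "p = (fst a, snd a @ snd s @ snd b)" "q = (fst a, snd a @ snd s' @ snd b)"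
    using assms by (auto simp: square_step_def Let_def)
  obtain u w where uw: "walk ?G u (snd s) w" "walk ?G u (snd s') w" "fst s = u" "fst s' = u"
    and chain: "path_chain (x, map Fwd (snd s)) - path_chain (x, map Fwd (snd s')) \<in> B1 k \<Lambda>"
    by (rule commuting_squares_boundary[OF ss])
  have w: "path_source ?G s = w"
    using uw by (auto simp: walk_def)
  have a: "walk ?G (fst a) (snd a) u" and b: "walk ?G w (snd b) (path_source ?G b)"
    using skel.walk_path_source[OF ab(1)] skel.walk_path_source[OF ab(2)] comp uw w by simp_all
  have "walk ?G (fst a) (snd a @ snd s @ snd b) (path_source ?G b)"
    "walk ?G (fst a) (snd a @ snd s' @ snd b) (path_source ?G b)"
    using skel.walk_appendI[OF a skel.walk_appendI[OF uw(1) b]]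
      skel.walk_appendI[OF a skel.walk_appendI[OF uw(2) b]] .
  then show "path_source ?G p = path_source ?G q"
    by (simp add: pq walk_def)
  show "fst p = fst q"
    by (simp add: pq)
  show "path_chain (x, map Fwd (snd p)) - path_chain (x, map Fwd (snd q)) \<in> B1 k \<Lambda>"
    using chain by (simp add: pq path_chain_append[of _ _ _ x])
qed

lemma square_rel_boundary:
  assumes "(p, q) \<in> square_rel k \<Lambda>"
  shows "fst p = fst q" "path_source (skeleton k \<Lambda>) p = path_source (skeleton k \<Lambda>) q"
    "path_chain (x, map Fwd (snd p)) - path_chain (x, map Fwd (snd q)) \<in> B1 k \<Lambda>"
proof -
  have "equivclp (square_step k \<Lambda>) p q"
    using assms by (simp add: square_rel_def)
  then have "fst p = fst q \<and> path_source (skeleton k \<Lambda>) p = path_source (skeleton k \<Lambda>) q \<and>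
    path_chain (x, map Fwd (snd p)) - path_chain (x, map Fwd (snd q)) \<in> B1 k \<Lambda>"
  proof (induction rule: equivclp_induct)
    case base
    show ?case by (simp add: B1_zero)
  next
    case (step y z)
    let ?c = "\<lambda>p. path_chain (x, map Fwd (snd p))"
    \<comment> \<open>A step of the generated equivalence may run in either direction; the backward
      one gives the negated difference.\<close>
    have "?c y - ?c z \<in> B1 k \<Lambda>"
      using step.hyps square_step_boundary(3)[of y z x] B1_minus[OF square_step_boundary(3)[of z y x]]
      by auto
    then have "?c p - ?c z \<in> B1 k \<Lambda>"
      using step.IH B1_add[of "?c p - ?c y" "?c y - ?c z"] by simp
    then show ?case
      using step square_step_boundary(1,2) by metis
  qed
  then show "fst p = fst q" "path_source (skeleton k \<Lambda>) p = path_source (skeleton k \<Lambda>) q"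
    "path_chain (x, map Fwd (snd p)) - path_chain (x, map Fwd (snd q)) \<in> B1 k \<Lambda>"
    by auto
qed

section \<open>Homologous paths\<close>

definition homologous :: "(('a \<times> 'a uedge list) \<times> ('a \<times> 'a uedge list)) set" where
  "homologous = {((u, es), (u, fs)) | u es fs. \<exists>w.
     walk (undirected (skeleton k \<Lambda>)) u es w \<and> walk (undirected (skeleton k \<Lambda>)) u fs w \<and>
     path_chain (u, es) - path_chain (u, fs) \<in> B1 k \<Lambda>}"

lemma homologous_iff:
  "((u, es), (u', fs)) \<in> homologous \<longleftrightarrow> u' = u \<and> (\<exists>w.
     walk (undirected (skeleton k \<Lambda>)) u es w \<and> walk (undirected (skeleton k \<Lambda>)) u fs w \<and>
     path_chain (u, es) - path_chain (u, fs) \<in> B1 k \<Lambda>)"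
  by (auto simp: homologous_def)

text \<open>Equivalence holds because \<open>B1\<close> is a subgroup, compatibility with
  composition because chains are additive. Since \<open>homotopy\<close> is the least congruence
  containing the generating relations, it lies in \<open>homologous\<close> as soon as those
  relations do.\<close>

lemma congruence_homologous: "congruence (path_category (undirected (skeleton k \<Lambda>))) homologous"
  unfolding congruence_def equiv_def
proof (intro conjI)
  let ?U = "undirected (skeleton k \<Lambda>)"
  show "homologous \<subseteq> Mor (path_category ?U) \<times> Mor (path_category ?U)"
    by (auto simp: homologous_def walk_def)
  show "refl_on (Mor (path_category ?U)) homologous"
    by (auto simp: refl_on_def homologous_iff walk_def B1_zero)
  show "sym homologous"
  proof (rule symI, clarsimp simp: homologous_iff)
    fix u es fs w
    assume "walk ?U u es w" "walk ?U u fs w" "path_chain (u, es) - path_chain (u, fs) \<in> B1 k \<Lambda>"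
    then show "\<exists>w. walk ?U u fs w \<and> walk ?U u es w \<and> path_chain (u, fs) - path_chain (u, es) \<in> B1 k \<Lambda>"
      using B1_minus[of "path_chain (u, es) - path_chain (u, fs)"] by auto
  qed
  show "trans homologous"
  proof (rule transI, clarsimp simp: homologous_iff)
    fix u es fs gs w w'
    assume *: "walk ?U u es w" "walk ?U u fs w" "walk ?U u fs w'" "walk ?U u gs w'"
      "path_chain (u, es) - path_chain (u, fs) \<in> B1 k \<Lambda>"
      "path_chain (u, fs) - path_chain (u, gs) \<in> B1 k \<Lambda>"
    then have "w' = w"
      using uskel.walk_source_unique by blast
    then show "\<exists>w. walk ?U u es w \<and> walk ?U u gs w \<and> path_chain (u, es) - path_chain (u, gs) \<in> B1 k \<Lambda>"
      using * B1_add[of "path_chain (u, es) - path_chain (u, fs)" "path_chain (u, fs) - path_chain (u, gs)"]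
      by auto
  qed
  show "\<forall>(f, f')\<in>homologous. rng (path_category ?U) f = rng (path_category ?U) f' \<and>
      src (path_category ?U) f = src (path_category ?U) f'"
    by (auto simp: homologous_def walk_def)
  have "((u, es @ es'), (x, fs @ fs')) \<in> homologous"
    if rel: "((u, es), (x, fs)) \<in> homologous" "((w, es'), (y, fs')) \<in> homologous"
      and w: "path_source ?U (u, es) = w" for u es x fs w es' y fs'
  proof -
    obtain z where z: "walk ?U w es' z" "walk ?U w fs' z" "path_chain (w, es') - path_chain (w, fs') \<in> B1 k \<Lambda>"
      using rel(2) by (auto simp: homologous_iff)
    have xw: "x = u" "walk ?U u es w" "walk ?U u fs w" "path_chain (u, es) - path_chain (u, fs) \<in> B1 k \<Lambda>"
      using rel(1) w by (auto simp: homologous_iff walk_def)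
    have "path_chain (u, es @ es') - path_chain (u, fs @ fs') =
      path_chain (u, es) - path_chain (u, fs) + (path_chain (w, es') - path_chain (w, fs'))"
      by (simp add: path_chain_append[of _ _ _ w])
    then show ?thesis
      using z xw B1_add uskel.walk_appendI by (auto simp: homologous_iff intro!: exI[of _ z])
  qed
  then show "\<forall>(f, f')\<in>homologous. \<forall>(g, g')\<in>homologous. src (path_category ?U) f = rng (path_category ?U) g \<longrightarrow>
      (cmp (path_category ?U) f g, cmp (path_category ?U) f' g') \<in> homologous"
    by clarsimp
qed

lemma cancel_rel_homologous: "cancel_rel (skeleton k \<Lambda>) \<subseteq> homologous"
proof (clarsimp simp: cancel_rel_def homologous_iff)
  fix e
  assume e: "e \<in> edges (undirected (skeleton k \<Lambda>))"
  then show "esrc (undirected (skeleton k \<Lambda>)) e \<in> vertices \<Lambda> \<and>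
      path_chain (esrc (undirected (skeleton k \<Lambda>)) e, [einv e, e]) \<in> B1 k \<Lambda>"
    using uskel.esrc_verts[OF e] by (cases e) (auto simp: B1_zero)
qed

lemma square_rel_plus_homologous: "square_rel_plus k \<Lambda> \<subseteq> homologous"
proof -
  let ?G = "skeleton k \<Lambda>"
  have fwd: "((u, map Fwd es), (w, map Fwd fs)) \<in> homologous"
    if "((u, es), (w, fs)) \<in> square_rel k \<Lambda>" for u es w fs
  proof -
    note sq = square_rel_boundary(1,2)[OF that, simplified] square_rel_boundary(3)[OF that, of w, simplified]
    have "walk ?G u es (path_source ?G (u, es))" "walk ?G w fs (path_source ?G (w, fs))"
      using that by (auto simp: square_rel_def walk_def)
    then show ?thesis
      using sq by (auto simp: homologous_iff intro!: exI[of _ "path_source ?G (w, fs)"] walk_map_Fwd)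
  qed
  have bwd: "((src \<Lambda> f, [Bwd f, Bwd e]), (src \<Lambda> h, [Bwd h, Bwd g])) \<in> homologous"
    if edges: "{e, f, g, h} \<subseteq> edges ?G"
      and rel: "((rng \<Lambda> e, [e, f]), (rng \<Lambda> g, [g, h])) \<in> square_rel k \<Lambda>" for e f g h
  proof -
    note sq = square_rel_boundary[OF rel, simplified]
    have "(rng \<Lambda> e, [e, f]) \<in> paths ?G" "(rng \<Lambda> g, [g, h]) \<in> paths ?G"
      using rel by (auto simp: square_rel_def)
    then have c: "src \<Lambda> e = rng \<Lambda> f" "src \<Lambda> g = rng \<Lambda> h"
      by (auto simp: paths_def)
    have s: "src \<Lambda> f = src \<Lambda> h" "rng \<Lambda> e = rng \<Lambda> g"
      using sq by (simp_all add: path_source_def)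
    have r: "rng \<Lambda> e \<in> vertices \<Lambda>"
      using skel.erng_verts[of e] edges by simp
    \<comment> \<open>Traversing both sides backwards negates their chains, so the forward
      difference only changes sign.\<close>
    have "- (frag_of e + frag_of f - (frag_of g + frag_of h)) \<in> B1 k \<Lambda>"
      using B1_minus[OF sq(3)] by simp
    then show ?thesis
      using edges c s r by (simp add: homologous_iff algebra_simps)
  qed
  show ?thesis
    unfolding square_rel_plus_def
  proof (intro Un_least subsetI; elim CollectE exE conjE)
    fix z u es w fs
    assume "z = ((u, map Fwd es), (w, map Fwd fs))" "((u, es), (w, fs)) \<in> square_rel k \<Lambda>"
    then show "z \<in> homologous"
      using fwd by simp
  next
    fix z e f g h
    assume z: "z = ((src \<Lambda> f, [Bwd f, Bwd e]), (src \<Lambda> h, [Bwd h, Bwd g]))"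
      and "{e, f, g, h} \<subseteq> edges ?G" "((rng \<Lambda> e, [e, f]), (rng \<Lambda> g, [g, h])) \<in> square_rel k \<Lambda>"
    then show "z \<in> homologous"
      unfolding z by (intro bwd)
  qed
qed

section \<open>The homotopy congruence\<close>

lemma homotopy_homologous: "homotopy k \<Lambda> \<subseteq> homologous"
  using congruence_homologous cancel_rel_homologous square_rel_plus_homologous
  unfolding homotopy_def generated_congruence_def undirected_paths_def by blast

text \<open>Since the generating pairs are homologous, they are pairs of parallel paths, as
  \<open>congruence_generated\<close> requires.\<close>

lemma congruence_homotopy:
  shows "congruence (path_category (undirected (skeleton k \<Lambda>))) (homotopy k \<Lambda>)"
    and "cancel_rel (skeleton k \<Lambda>) \<union> square_rel_plus k \<Lambda> \<subseteq> homotopy k \<Lambda>"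
proof -
  let ?P = "path_category (undirected (skeleton k \<Lambda>))"
  let ?R = "cancel_rel (skeleton k \<Lambda>) \<union> square_rel_plus k \<Lambda>"
  have R: "?R \<subseteq> homologous"
    using cancel_rel_homologous square_rel_plus_homologous by blast
  then have "?R \<subseteq> Mor ?P \<times> Mor ?P"
    using congruence_homologous by (auto simp: congruence_def equiv_def)
  moreover have "rng ?P f = rng ?P f' \<and> src ?P f = src ?P f'" if "(f, f') \<in> ?R" for f f'
    using that R congruence_homologous unfolding congruence_def by blast
  ultimately show "congruence ?P (homotopy k \<Lambda>)" "?R \<subseteq> homotopy k \<Lambda>"
    using congruence_generated[OF uskel.category_path_category]
    unfolding homotopy_def undirected_paths_def by blast+
qed

sublocale htpy: undirected_congruence "skeleton k \<Lambda>" "homotopy k \<Lambda>"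
  using congruence_homotopy by unfold_locales auto

text \<open>The converse direction to the estimates on chains: the two factorisations of a square
  give homotopic paths. It will show that boundaries of squares die in the abelianised fundamental
  group.\<close>

lemma homotopic_square:
  assumes "i \<in> {1..k}" "j \<in> {1..k}" "i \<noteq> j" "square_factors \<Lambda> i j x f\<^sub>1 g\<^sub>1 f\<^sub>2 g\<^sub>2"
  shows "htpy.homotopic (rng \<Lambda> x) [Fwd f\<^sub>1, Fwd g\<^sub>1] [Fwd g\<^sub>2, Fwd f\<^sub>2]"
    and "walk (undirected (skeleton k \<Lambda>)) (rng \<Lambda> x) [Fwd f\<^sub>1, Fwd g\<^sub>1] (src \<Lambda> x)"
    and "walk (undirected (skeleton k \<Lambda>)) (rng \<Lambda> x) [Fwd g\<^sub>2, Fwd f\<^sub>2] (src \<Lambda> x)"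
proof -
  let ?G = "skeleton k \<Lambda>"
  note sf = assms(4)[unfolded square_factors_def]
  have x: "rng \<Lambda> f\<^sub>1 = rng \<Lambda> x" "rng \<Lambda> g\<^sub>2 = rng \<Lambda> x" "src \<Lambda> g\<^sub>1 = src \<Lambda> x" "src \<Lambda> f\<^sub>2 = src \<Lambda> x"
    "x \<in> Mor \<Lambda>"
    using sf rng_cmp[of f\<^sub>1 g\<^sub>1] rng_cmp[of g\<^sub>2 f\<^sub>2] src_cmp[of f\<^sub>1 g\<^sub>1] src_cmp[of g\<^sub>2 f\<^sub>2] cmp_closed[of f\<^sub>1 g\<^sub>1]
    by (auto simp: graded_def)
  have verts: "rng \<Lambda> x \<in> vertices \<Lambda>" "src \<Lambda> x \<in> vertices \<Lambda>"
    using x(5) by (auto simp: vertices_eq rng_closed src_closed rng_rng rng_src)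
  have walks: "walk ?G (rng \<Lambda> x) [f\<^sub>1, g\<^sub>1] (src \<Lambda> x)" "walk ?G (rng \<Lambda> x) [g\<^sub>2, f\<^sub>2] (src \<Lambda> x)"
    using sf assms(1,2) x verts by auto
  then show "walk (undirected ?G) (rng \<Lambda> x) [Fwd f\<^sub>1, Fwd g\<^sub>1] (src \<Lambda> x)"
    "walk (undirected ?G) (rng \<Lambda> x) [Fwd g\<^sub>2, Fwd f\<^sub>2] (src \<Lambda> x)"
    using walk_map_Fwd by fastforce+
  have cs: "((rng \<Lambda> f\<^sub>1, [f\<^sub>1, g\<^sub>1]), (rng \<Lambda> g\<^sub>2, [g\<^sub>2, f\<^sub>2])) \<in> commuting_squares k \<Lambda>"
    using sf assms(1-3) unfolding commuting_squares_def by blast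
  \<comment> \<open>The square is rewritten in the trivial context, with the vertices at its two
    ends as prefix and suffix.\<close>
  have "square_step k \<Lambda> (rng \<Lambda> x, [f\<^sub>1, g\<^sub>1]) (rng \<Lambda> x, [g\<^sub>2, f\<^sub>2])"
    unfolding square_step_def Let_def
    using cs walks verts x
    by (intro bexI[of _ "(rng \<Lambda> x, [])"] bexI[of _ "(src \<Lambda> x, [])"] bexI[OF _ cs])
      (auto simp: paths_def walk_def)
  then have "((rng \<Lambda> x, [f\<^sub>1, g\<^sub>1]), (rng \<Lambda> x, [g\<^sub>2, f\<^sub>2])) \<in> square_rel k \<Lambda>"
    using walks by (auto simp: square_rel_def walk_def)
  then have "((rng \<Lambda> x, map Fwd [f\<^sub>1, g\<^sub>1]), (rng \<Lambda> x, map Fwd [g\<^sub>2, f\<^sub>2])) \<in> square_rel_plus k \<Lambda>"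
    unfolding square_rel_plus_def by blast
  then show "htpy.homotopic (rng \<Lambda> x) [Fwd f\<^sub>1, Fwd g\<^sub>1] [Fwd g\<^sub>2, Fwd f\<^sub>2]"
    using congruence_homotopy(2) by auto
qed

section \<open>Connectedness of the skeleton\<close>

lemma morphism_walk: "x \<in> Mor \<Lambda> \<Longrightarrow> \<exists>es. walk (skeleton k \<Lambda>) (rng \<Lambda> x) es (src \<Lambda> x)"
\<comment> \<open>Connectedness of \<Lambda> is phrased with arbitrary morphisms. Factorisation
  splits off one edge at a time, which lowers the total degree.\<close>
proof (induction "\<Sum>i\<in>{1..k}. deg \<Lambda> x i" arbitrary: x rule: less_induct)
  case less
  note x = \<open>x \<in> Mor \<Lambda>\<close> deg_degrees[OF \<open>x \<in> Mor \<Lambda>\<close>]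
  show ?case
  proof (cases "\<exists>i\<in>{1..k}. deg \<Lambda> x i > 0")
    case False
    then have "deg \<Lambda> x i = 0" for i
      using x(2) by (cases "i \<in> {1..k}") (auto simp: degrees_def)
    then have "deg \<Lambda> x = (\<lambda>_. 0)" ..
    then have v: "x \<in> vertices \<Lambda>"
      using x(1) by (simp add: vertices_def graded_def)
    then have "rng \<Lambda> x = x" "src \<Lambda> x = x"
      using src_rng[of x] by (auto simp: vertices_eq)
    then show ?thesis
      using v by (intro exI[of _ "[]"]) simp
  next
    case True
    then obtain i where i: "i \<in> {1..k}" "deg \<Lambda> x i > 0"
      by blast
    \<comment> \<open>Truncated subtraction is exact here, since the degree of \<open>x\<close> is
      positive in coordinate \<open>i\<close>.\<close>
    define n where "n = (\<lambda>j. deg \<Lambda> x j - unit_deg i j)"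
    have n: "n \<in> degrees k" "deg \<Lambda> x = add_deg (unit_deg i) n"
      using x(2) i by (auto simp: n_def degrees_def add_deg_def unit_deg_def)
    then obtain y z where yz: "y \<in> graded \<Lambda> (unit_deg i)" "z \<in> graded \<Lambda> n" "src \<Lambda> y = rng \<Lambda> z"
        "x = cmp \<Lambda> y z"
      using factorisation[OF x(1) unit_deg_degrees[OF i(1)]] by blast
    have Mor: "y \<in> Mor \<Lambda>" "z \<in> Mor \<Lambda>" "deg \<Lambda> z = n"
      using yz by (auto simp: graded_def)
    have "(\<Sum>j\<in>{1..k}. deg \<Lambda> z j) < (\<Sum>j\<in>{1..k}. deg \<Lambda> x j)"
      using i n(2) Mor(3) by (intro sum_strict_mono_ex1) (auto simp: add_deg_def unit_deg_def)
    then obtain es where "walk (skeleton k \<Lambda>) (rng \<Lambda> z) es (src \<Lambda> z)"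
      using less.hyps Mor(2) by blast
    then have "walk (skeleton k \<Lambda>) (rng \<Lambda> x) (y # es) (src \<Lambda> x)"
      using yz i Mor by (auto simp: rng_cmp src_cmp)
    then show ?thesis ..
  qed
qed

lemma connected_walk:
  assumes "kgraph_connected \<Lambda>" "v \<in> vertices \<Lambda>" "u \<in> vertices \<Lambda>"
  shows "\<exists>es. walk (undirected (skeleton k \<Lambda>)) v es u"
proof -
  have "equivclp (\<lambda>u w. \<exists>x \<in> Mor \<Lambda>. rng \<Lambda> x = u \<and> src \<Lambda> x = w) v u"
    using assms by (simp add: kgraph_connected_def)
  then show ?thesis
  proof (induction rule: equivclp_induct)
    case base
    show ?case
      using assms(2) by (intro exI[of _ "[]"]) simp
  next
    case (step y z)
    \<comment> \<open>The morphism may point either way along the zigzag; in the second case its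
      walk is reversed.\<close>
    have "\<exists>es. walk (undirected (skeleton k \<Lambda>)) y es z"
      using step.hyps morphism_walk walk_map_Fwd skel.walk_inverse by metis
    then show ?case
      using step.IH uskel.walk_appendI by blast
  qed
qed

section \<open>Cycles modulo boundaries\<close>

lemma boundary1_eq: "boundary1 \<Lambda> = graph_boundary (skeleton k \<Lambda>)"
  by (simp add: boundary1_def graph_boundary_def)

lemma C1_eq: "C1 k \<Lambda> = free_Abelian_group (edges (skeleton k \<Lambda>))"
  by (simp add: C1_def)

lemma carrier_Z1:
  "c \<in> carrier (Z1 k \<Lambda>) \<longleftrightarrow>
     Poly_Mapping.keys c \<subseteq> edges (skeleton k \<Lambda>) \<and> boundary1 \<Lambda> c = 0"
  by (simp add: Z1_def kernel_def C1_def C0_def)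

lemma mult_Z1 [simp]: "a \<otimes>\<^bsub>Z1 k \<Lambda>\<^esub> b = a + b"
  by (simp add: Z1_def C1_def)

lemma one_Z1 [simp]: "\<one>\<^bsub>Z1 k \<Lambda>\<^esub> = 0"
  by (simp add: Z1_def C1_def)

lemma Z1_diff: "a \<in> carrier (Z1 k \<Lambda>) \<Longrightarrow> b \<in> carrier (Z1 k \<Lambda>) \<Longrightarrow> a - b \<in> carrier (Z1 k \<Lambda>)"
  using keys_diff[of a b] by (fastforce simp: carrier_Z1 boundary1_def frag_extend_diff)

lemma Z1_zero: "0 \<in> carrier (Z1 k \<Lambda>)"
  by (simp add: carrier_Z1 boundary1_def)

lemma Z1_minus: "a \<in> carrier (Z1 k \<Lambda>) \<Longrightarrow> - a \<in> carrier (Z1 k \<Lambda>)"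
  using Z1_diff[OF Z1_zero] by simp

lemma Z1_add: "a \<in> carrier (Z1 k \<Lambda>) \<Longrightarrow> b \<in> carrier (Z1 k \<Lambda>) \<Longrightarrow> a + b \<in> carrier (Z1 k \<Lambda>)"
  using Z1_diff[of a "- b"] Z1_minus by simp

lemma comm_group_Z1: "comm_group (Z1 k \<Lambda>)"
proof (rule comm_groupI)
  show "\<exists>y\<in>carrier (Z1 k \<Lambda>). y \<otimes>\<^bsub>Z1 k \<Lambda>\<^esub> x = \<one>\<^bsub>Z1 k \<Lambda>\<^esub>" if "x \<in> carrier (Z1 k \<Lambda>)" for x
    using Z1_minus[OF that] by (intro bexI[of _ "- x"]) auto
qed (auto simp: Z1_add Z1_zero add.assoc add.commute)

lemma inv_Z1: "a \<in> carrier (Z1 k \<Lambda>) \<Longrightarrow> inv\<^bsub>Z1 k \<Lambda>\<^esub> a = - a"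
  using comm_group_Z1 Z1_minus
  by (intro group.inv_equality) (auto simp: comm_group_def)

lemma B1_subset_Z1: "B1 k \<Lambda> \<subseteq> carrier (Z1 k \<Lambda>)"
  using boundary1_boundary2 by (auto simp: B1_def carrier_Z1 C1_def)

lemma subgroup_B1: "subgroup (B1 k \<Lambda>) (Z1 k \<Lambda>)"
  using B1_subset_Z1 by unfold_locales (auto simp: B1_add B1_zero B1_minus inv_Z1)

lemma normal_B1: "B1 k \<Lambda> \<lhd> Z1 k \<Lambda>"
  using comm_group.subgroup_imp_normal[OF comm_group_Z1 subgroup_B1] .

lemma comm_group_H1: "comm_group (H1 k \<Lambda>)"
  unfolding H1_def by (rule comm_group.abelian_FactGroup[OF comm_group_Z1 subgroup_B1])

lemma carrier_H1: "carrier (H1 k \<Lambda>) = homology_class k \<Lambda> ` carrier (Z1 k \<Lambda>)"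
  by (simp add: H1_def carrier_FactGroup homology_class_def)

lemma mult_H1:
  assumes "a \<in> carrier (Z1 k \<Lambda>)" "b \<in> carrier (Z1 k \<Lambda>)"
  shows "homology_class k \<Lambda> a \<otimes>\<^bsub>H1 k \<Lambda>\<^esub> homology_class k \<Lambda> b = homology_class k \<Lambda> (a + b)"
  using normal.rcos_sum[OF normal_B1 assms] by (simp add: H1_def homology_class_def)

text \<open>The coset is formed by plain addition of chains, so the criterion holds for all chains
  and not only for cycles. This lets \<open>hurewicz_class\<close> speak of paths that may fail to
  be closed.\<close>

lemma homology_class_eq_iff: "homology_class k \<Lambda> a = homology_class k \<Lambda> b \<longleftrightarrow> a - b \<in> B1 k \<Lambda>"
proof -
  have mem: "c \<in> homology_class k \<Lambda> d \<longleftrightarrow> c - d \<in> B1 k \<Lambda>" for c d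
    by (auto simp: homology_class_def r_coset_def intro: bexI[of _ "c - d"])
  show ?thesis
  proof
    assume "homology_class k \<Lambda> a = homology_class k \<Lambda> b"
    then show "a - b \<in> B1 k \<Lambda>"
      using mem[of a a] mem[of a b] B1_zero by simp
  next
    assume ab: "a - b \<in> B1 k \<Lambda>"
    show "homology_class k \<Lambda> a = homology_class k \<Lambda> b"
      using B1_add[OF _ ab] B1_diff[OF _ ab] by (fastforce simp: mem)
  qed
qed

lemma one_H1: "\<one>\<^bsub>H1 k \<Lambda>\<^esub> = homology_class k \<Lambda> 0"
  by (auto simp: H1_def homology_class_def r_coset_def)

section \<open>The Hurewicz homomorphism\<close>

lemma path_chain_in_Z1:
  "walk (undirected (skeleton k \<Lambda>)) v es v \<Longrightarrow> path_chain (x :: 'a, es) \<in> carrier (Z1 k \<Lambda>)"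
  using skel.keys_path_chain skel.graph_boundary_path_chain
  by (simp add: carrier_Z1 boundary1_eq del: skeleton_sel)

text \<open>All members of a homotopy class contribute the same homology class, so the union is that class.\<close>

definition hurewicz :: "('a \<times> 'a uedge list) set \<Rightarrow> ('a \<Rightarrow>\<^sub>0 int) set" where
  "hurewicz X = (\<Union>h\<in>X. homology_class k \<Lambda> (path_chain h))"

lemma hurewicz_class:
  assumes "h \<in> paths (undirected (skeleton k \<Lambda>))"
  shows "hurewicz (homotopy k \<Lambda> `` {h}) = homology_class k \<Lambda> (path_chain h)"
  unfolding hurewicz_def
proof (rule htpy.class_union_const)
  fix g assume "(h, g) \<in> homotopy k \<Lambda>"
  then have "path_chain h - path_chain g \<in> B1 k \<Lambda>"
    using homotopy_homologous by (auto simp: homologous_def)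
  then show "homology_class k \<Lambda> (path_chain g) = homology_class k \<Lambda> (path_chain h)"
    by (simp add: homology_class_eq_iff[symmetric])
qed (use assms in simp)

lemma hurewicz_loop_class:
  "walk (undirected (skeleton k \<Lambda>)) v es v \<Longrightarrow>
    hurewicz (homotopy k \<Lambda> `` {(v, es)}) = homology_class k \<Lambda> (path_chain (v, es))"
  by (rule hurewicz_class) (simp add: walk_def)

lemma fundamental_group_eq: "fundamental_group k \<Lambda> v = htpy.fundamental v"
  by (simp add: fundamental_group_def fundamental_groupoid_def undirected_paths_def path_class_def)

lemma group_hom_hurewicz:
  assumes "v \<in> vertices \<Lambda>"
  shows "group_hom (htpy.fundamental v) (H1 k \<Lambda>) hurewicz"
proof -
  have v: "v \<in> verts (skeleton k \<Lambda>)"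
    using assms by simp
  have "hurewicz \<in> hom (htpy.fundamental v) (H1 k \<Lambda>)"
  proof (rule homI)
    fix X assume "X \<in> carrier (htpy.fundamental v)"
    then show "hurewicz X \<in> carrier (H1 k \<Lambda>)"
      using path_chain_in_Z1 by (auto simp: htpy.carrier_fundamental[OF v] hurewicz_loop_class carrier_H1)
  next
    fix X Y assume "X \<in> carrier (htpy.fundamental v)" "Y \<in> carrier (htpy.fundamental v)"
    then obtain es fs where XY: "X = homotopy k \<Lambda> `` {(v, es)}" "Y = homotopy k \<Lambda> `` {(v, fs)}"
      and walks: "walk (undirected (skeleton k \<Lambda>)) v es v" "walk (undirected (skeleton k \<Lambda>)) v fs v"
      by (auto simp: htpy.carrier_fundamental[OF v])
    then show "hurewicz (X \<otimes>\<^bsub>htpy.fundamental v\<^esub> Y) = hurewicz X \<otimes>\<^bsub>H1 k \<Lambda>\<^esub> hurewicz Y"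
      using uskel.walk_appendI[OF walks] path_chain_in_Z1
      by (simp add: htpy.mult_fundamental hurewicz_loop_class mult_H1 path_chain_append[of _ _ _ v])
  qed
  then show ?thesis
    using htpy.group_fundamental[OF v] comm_group_H1
    by (simp add: group_hom_def group_hom_axioms_def comm_group_def)
qed

text \<open>Writes the boundary of a square as a difference of chains of homotopic paths, the form
  in which a homomorphism that depends only on homotopy classes can be seen to kill it.\<close>

lemma square_boundary_path_chain:
  assumes "x \<in> squares"
  obtains es fs where "walk (undirected (skeleton k \<Lambda>)) (rng \<Lambda> x) es (src \<Lambda> x)"
    "walk (undirected (skeleton k \<Lambda>)) (rng \<Lambda> x) fs (src \<Lambda> x)"
    "htpy.homotopic (rng \<Lambda> x) es fs"
    "square_boundary k \<Lambda> x = path_chain (rng \<Lambda> x, es) - path_chain (rng \<Lambda> x, fs)"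
proof -
  obtain i j where ij: "1 \<le> i" "i < j" "j \<le> k" "x \<in> graded \<Lambda> (add_deg (unit_deg i) (unit_deg j))"
    using assms by (auto simp: squares_def)
  then have ij': "i \<in> {1..k}" "j \<in> {1..k}" "i \<noteq> j"
    by auto
  obtain f\<^sub>1 g\<^sub>1 f\<^sub>2 g\<^sub>2 where sf: "square_factors \<Lambda> i j x f\<^sub>1 g\<^sub>1 f\<^sub>2 g\<^sub>2"
    by (rule square_factors_exist[OF ij(4) ij'(1,2)])
  have "square_boundary k \<Lambda> x =
      path_chain (rng \<Lambda> x, [Fwd f\<^sub>1, Fwd g\<^sub>1]) - path_chain (rng \<Lambda> x, [Fwd g\<^sub>2, Fwd f\<^sub>2])"
    by (simp add: square_boundary_eq[OF ij(1-3) sf])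
  with homotopic_square[OF ij' sf] that show ?thesis
    by blast
qed

text \<open>Surjectivity comes from \<open>chain_of_loop\<close>. The derived subgroup lies in the
  kernel because \<open>H1\<close> is commutative; for the other inclusion, \<open>\<theta>\<close>
  recovers the class of a loop in the abelianisation from its chain and vanishes on
  boundaries.\<close>

lemma hurewicz_kernel_image:
  assumes conn: "kgraph_connected \<Lambda>" and v: "v \<in> vertices \<Lambda>"
  shows "kernel (htpy.fundamental v) (H1 k \<Lambda>) hurewicz =
      derived (htpy.fundamental v) (carrier (htpy.fundamental v))" (is "?K = ?D")
    and "hurewicz ` carrier (htpy.fundamental v) = carrier (H1 k \<Lambda>)"
proof -
  let ?U = "undirected (skeleton k \<Lambda>)"
  let ?G = "htpy.fundamental v"
  have vG: "v \<in> verts (skeleton k \<Lambda>)"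
    using v by simp
  interpret H: group_hom ?G "H1 k \<Lambda>" hurewicz
    by (rule group_hom_hurewicz[OF v])
  obtain p where p: "\<And>u. u \<in> vertices \<Lambda> \<Longrightarrow> walk ?U v (p u) u"
    using connected_walk[OF conn v] by metis
  interpret p: based_connections "skeleton k \<Lambda>" "homotopy k \<Lambda>" v p
    by unfold_locales (use v p in auto)
  show "hurewicz ` carrier ?G = carrier (H1 k \<Lambda>)"
  proof (rule equalityI)
    show "carrier (H1 k \<Lambda>) \<subseteq> hurewicz ` carrier ?G"
    proof
      fix y assume "y \<in> carrier (H1 k \<Lambda>)"
      then obtain c where c: "y = homology_class k \<Lambda> c" "c \<in> carrier (Z1 k \<Lambda>)"
        by (auto simp: carrier_H1)
      \<comment> \<open>For the cycle \<open>c\<close> the correction term of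
        \<open>chain_of_loop\<close> is zero.\<close>
      then obtain es where "walk ?U v es v" "path_chain (v, es) = c"
        using p.chain_of_loop[of c] by (auto simp: carrier_Z1 boundary1_eq)
      then show "y \<in> hurewicz ` carrier ?G"
        using c hurewicz_loop_class by (force simp: htpy.carrier_fundamental[OF vG])
    qed
  qed auto
  show "?K = ?D"
  proof (rule equalityI)
    \<comment> \<open>The image is the derived subgroup of a commutative group, hence
      trivial.\<close>
    have "hurewicz ` ?D = {\<one>\<^bsub>H1 k \<Lambda>\<^esub>}"
      using H.derived_img[of "carrier ?G"]
        comm_group.derived_eq_singleton[OF comm_group_H1, of "hurewicz ` carrier ?G"]
      by (simp add: image_subset_iff)
    then show "?D \<subseteq> ?K"
      using H.G.derived_in_carrier[of "carrier ?G"] by (auto simp: kernel_def)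
    have normal: "?D \<lhd> ?G"
      by (rule H.G.derived_is_normal[OF H.G.normal_self])
    \<comment> \<open>The projection onto the abelianisation is the homomorphism to which
      \<open>path_chain_hom\<close> is applied.\<close>
    define q where "q = (\<lambda>X. ?D #>\<^bsub>?G\<^esub> X)"
    have comm: "comm_group (?G Mod ?D)"
      by (rule H.G.derived_quot_is_comm_group)
    have q: "q \<in> hom ?G (?G Mod ?D)"
      unfolding q_def by (rule normal.r_coset_hom_Mod[OF normal])
    interpret A: comm_group "?G Mod ?D" by (fact comm)
    obtain \<theta> where \<theta>: "\<theta> \<in> hom (free_Abelian_group (edges (skeleton k \<Lambda>))) (?G Mod ?D)"
      and \<theta>_walk: "\<And>u es w. walk ?U u es w \<Longrightarrow>
        \<theta> (path_chain (u, es)) = q (homotopy k \<Lambda> `` {(v, p.close_up u es w)})"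
      by (rule p.path_chain_hom[OF comm q]) blast
    interpret \<theta>: group_hom "C1 k \<Lambda>" "?G Mod ?D" \<theta>
      using \<theta> A.is_group by (simp add: group_hom_def group_hom_axioms_def C1_eq)
    have \<theta>_diff: "\<theta> (a - b) = \<theta> a \<otimes>\<^bsub>?G Mod ?D\<^esub> inv\<^bsub>?G Mod ?D\<^esub> \<theta> b"
      if "a \<in> carrier (C1 k \<Lambda>)" "b \<in> carrier (C1 k \<Lambda>)" for a b
      using that \<theta>.hom_mult[of a "- b"] \<theta>.hom_inv[of b] by (simp add: C1_eq)
    have \<theta>_square: "\<theta> (square_boundary k \<Lambda> x) = \<one>\<^bsub>?G Mod ?D\<^esub>" if x: "x \<in> squares" for x
    proof -
      obtain es fs where walks: "walk ?U (rng \<Lambda> x) es (src \<Lambda> x)" "walk ?U (rng \<Lambda> x) fs (src \<Lambda> x)"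
        and hom: "htpy.homotopic (rng \<Lambda> x) es fs"
        and bd: "square_boundary k \<Lambda> x = path_chain (rng \<Lambda> x, es) - path_chain (rng \<Lambda> x, fs)"
        by (rule square_boundary_path_chain[OF x])
      have verts: "rng \<Lambda> x \<in> vertices \<Lambda>" "src \<Lambda> x \<in> vertices \<Lambda>"
        using uskel.walk_verts[OF walks(1)] by simp_all
      \<comment> \<open>Closing up both sides of the square with the same connecting walks preserves
        their homotopy, so \<open>\<theta>\<close> takes the same value on both chains.\<close>
      have "htpy.homotopic v (p.close_up (rng \<Lambda> x) es (src \<Lambda> x)) (p.close_up (rng \<Lambda> x) fs (src \<Lambda> x))"
        unfolding p.close_up_def
        using p[OF verts(1)] hom walks(1) skel.walk_inverse[OF p[OF verts(2)]]
        by (rule htpy.homotopic_context)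
      then have eq: "\<theta> (path_chain (rng \<Lambda> x, es)) = \<theta> (path_chain (rng \<Lambda> x, fs))"
        using \<theta>_walk[OF walks(1)] \<theta>_walk[OF walks(2)] htpy.homotopic_class_eq by simp
      have C1: "path_chain (rng \<Lambda> x, es) \<in> carrier (C1 k \<Lambda>)" "path_chain (rng \<Lambda> x, fs) \<in> carrier (C1 k \<Lambda>)"
        using skel.keys_path_chain[OF walks(1)] skel.keys_path_chain[OF walks(2)]
        by (simp_all add: C1_eq del: skeleton_sel)
      show ?thesis
        unfolding bd \<theta>_diff[OF C1] eq by (rule A.r_inv[OF \<theta>.hom_closed[OF C1(2)]])
    qed
    have \<theta>_boundary: "\<theta> (boundary2 k \<Lambda> c) = \<one>\<^bsub>?G Mod ?D\<^esub>" if "Poly_Mapping.keys c \<subseteq> squares" for c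
    proof (rule free_Abelian_group_induct[OF that])
      show "\<theta> (boundary2 k \<Lambda> 0) = \<one>\<^bsub>?G Mod ?D\<^esub>"
        using \<theta>.hom_one by (simp add: boundary2_def C1_eq)
    next
      fix a b
      assume "Poly_Mapping.keys a \<subseteq> squares" "Poly_Mapping.keys b \<subseteq> squares"
        and one: "\<theta> (boundary2 k \<Lambda> a) = \<one>\<^bsub>?G Mod ?D\<^esub>" "\<theta> (boundary2 k \<Lambda> b) = \<one>\<^bsub>?G Mod ?D\<^esub>"
      then have "\<theta> (boundary2 k \<Lambda> (a - b)) =
          \<theta> (boundary2 k \<Lambda> a) \<otimes>\<^bsub>?G Mod ?D\<^esub> inv\<^bsub>?G Mod ?D\<^esub> \<theta> (boundary2 k \<Lambda> b)"
        using \<theta>_diff boundary1_boundary2(1) by (simp add: carrier_C2 boundary2_def frag_extend_diff)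
      then show "\<theta> (boundary2 k \<Lambda> (a - b)) = \<one>\<^bsub>?G Mod ?D\<^esub>"
        unfolding one using A.r_inv[OF A.one_closed] by (rule trans)
    next
      fix x assume "x \<in> squares"
      then show "\<theta> (boundary2 k \<Lambda> (frag_of x)) = \<one>\<^bsub>?G Mod ?D\<^esub>"
        using \<theta>_square by (simp add: boundary2_def)
    qed
    show "?K \<subseteq> ?D"
    proof
      fix X assume "X \<in> ?K"
      then obtain es where es: "X = homotopy k \<Lambda> `` {(v, es)}" "walk ?U v es v"
        and one: "hurewicz X = \<one>\<^bsub>H1 k \<Lambda>\<^esub>" and X: "X \<in> carrier ?G"
        by (auto simp: kernel_def htpy.carrier_fundamental[OF vG])
      then have "path_chain (v, es) \<in> B1 k \<Lambda>"
        by (simp add: hurewicz_loop_class one_H1 homology_class_eq_iff)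
      then have "\<theta> (path_chain (v, es)) = \<one>\<^bsub>?G Mod ?D\<^esub>"
        using \<theta>_boundary by (auto simp: B1_def carrier_C2)
      \<comment> \<open>By \<open>\<theta>_walk\<close>, \<open>\<theta>\<close> sends the chain to
        the class of the closed-up loop, which equals \<open>q X\<close> since conjugation is
        trivial in the quotient.\<close>
      then have "q X = ?D"
        using \<theta>_walk[OF es(2)] p.class_close_up_loop[OF comm q es(2)] es(1) by simp
      then show "X \<in> ?D"
        using H.G.rcos_self[OF X H.G.derived_is_subgroup[of "carrier ?G"]] by (simp add: q_def)
    qed
  qed
qed

end

section \<open>The induced isomorphism on the abelianisation\<close>

theorem proposition6p2:
  fixes k :: nat and \<Lambda> :: "'a kgraph" and v :: 'a
  assumes "k \<ge> 1"
    and "kgraph k \<Lambda>"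
    and "kgraph_connected \<Lambda>"
    and "v \<in> vertices \<Lambda>"
  shows "\<exists>\<phi> \<in> iso (abelianisation (fundamental_group k \<Lambda> v)) (H1 k \<Lambda>).
    \<forall>h \<in> Mor (undirected_paths k \<Lambda>).
      rng (undirected_paths k \<Lambda>) h = (v, []) \<and> src (undirected_paths k \<Lambda>) h = (v, []) \<longrightarrow>
      \<phi> (abelianisation_class (fundamental_group k \<Lambda> v) (path_class k \<Lambda> h)) =
        homology_class k \<Lambda> (path_chain h)"
proof -
  interpret kgraph k \<Lambda> by fact
  let ?G = "htpy.fundamental v"
  interpret H: group_hom ?G "H1 k \<Lambda>" hurewicz
    by (rule group_hom_hurewicz[OF assms(4)])
  note kernel = hurewicz_kernel_image[OF assms(3,4)]
  obtain \<phi> where \<phi>: "\<phi> = (\<lambda>X. the_elem (hurewicz ` X))"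
    by blast
  \<comment> \<open>The first isomorphism theorem for the surjective map \<open>hurewicz\<close>,
    whose kernel is the derived subgroup.\<close>
  have "\<phi> \<in> iso (abelianisation ?G) (H1 k \<Lambda>)"
    using H.FactGroup_iso_set[OF kernel(2)] by (simp add: \<phi> abelianisation_def kernel(1))
  moreover have "\<phi> (abelianisation_class ?G (path_class k \<Lambda> h)) = homology_class k \<Lambda> (path_chain h)"
    if h: "h \<in> Mor (undirected_paths k \<Lambda>)" "rng (undirected_paths k \<Lambda>) h = (v, [])"
      "src (undirected_paths k \<Lambda>) h = (v, [])" for h
  proof -
    let ?X = "path_class k \<Lambda> h"
    have paths: "h \<in> paths (undirected (skeleton k \<Lambda>))"
      using h(1) by (simp add: undirected_paths_def)
    obtain es where "h = (v, es)" "walk (undirected (skeleton k \<Lambda>)) v es v"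
      using h by (cases h) (auto simp: undirected_paths_def walk_def)
    then have X: "?X \<in> carrier ?G"
      using assms(4) by (auto simp: htpy.carrier_fundamental path_class_def)
    \<comment> \<open>The map is constant on cosets of its kernel, so \<open>the_elem\<close> picks
      the value at the given representative.\<close>
    have "hurewicz Y = hurewicz ?X" if "Y \<in> kernel ?G (H1 k \<Lambda>) hurewicz #>\<^bsub>?G\<^esub> ?X" for Y
      using that X H.hom_closed[OF X] by (auto simp: kernel_def r_coset_def)
    then have "hurewicz ` (kernel ?G (H1 k \<Lambda>) hurewicz #>\<^bsub>?G\<^esub> ?X) = {hurewicz ?X}"
      using H.G.rcos_self[OF X H.subgroup_kernel] by blast
    then show ?thesis
      by (simp add: \<phi> abelianisation_class_def kernel(1)[symmetric] path_class_def hurewicz_class[OF paths])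
  qed
  ultimately show ?thesis
    unfolding fundamental_group_eq by blast
qed

end
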